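(* Let $1\le i\le k$, let $S=\{i,i+1,\ldots,k\}$ and let $f_{S,k}=\mathrm{Th}^i_k:\{-1,1\}^k\to\{0,1\}$ be the threshold function ($\mathrm{Th}^i_k(\mathbf x)=1$ iff at least $i$ coordinates of $\mathbf x$ equal $1$). Then for every $\epsilon>0$, there exist a piecewise linear function $\gamma:[-1,1]\to[0,1]$ and a constant $\epsilon'>0$ such that the following is a sketching $(\alpha(f_{S,k})-\epsilon)$-approximation for $\mathsf{Max\text{-}CSP}(f_{S,k})$: on input $\Psi$, compute an estimate $\hat b$ for $\mathrm{bias}(\Psi)$ up to a multiplicative $(1\pm\epsilon')$ error and output $\gamma(\hat b)$.
   Context: **CSPs.** An $n$-variable instance $\Psi$ of $\mathsf{Max\text{-}CSP}(f)$, $f:\{-1,1\}^k\to\{0,1\}$, is a list of constraints $(\mathbf b(\ell),\mathbf j(\ell))$, $\ell\in[m]$, with non-negative real weights $w_\ell$ and total weight $W=\sum_\ell w_\ell$, where $\mathbf j(\ell)\in[n]^k$ has distinct entries and $\mathbf b(\ell)\in\{-1,1\}^k$. For $\boldsymbol\sigma\in\{-1,1\}^n$, $\mathrm{val}_\Psi(\boldsymbol\sigma)=\frac1W\sum_\ell w_\ell f(\mathbf b(\ell)\odot\boldsymbol\sigma|_{\mathbf j(\ell)})$, with $\odot$ the coordinatewise product and $\boldsymbol\sigma|_{\mathbf j}=(\sigma_{j_1},\dots,\sigma_{j_k})$; $\mathrm{val}_\Psi=\max_{\boldsymbol\sigma}\mathrm{val}_\Psi(\boldsymbol\sigma)$.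 An algorithm $\mathcal A$ is an $a$-approximation if on every input instance $\Psi$, with probability at least $2/3$, $a\cdot\mathrm{val}_\Psi\le\mathcal A(\Psi)\le\mathrm{val}_\Psi$. The input is given as a stream of (weighted) constraints. **Bias.** For a variable index $v\in[n]$, $\mathrm{diff}_v(\Psi)=\sum_{\ell,t:\ j(\ell)_t=v}b(\ell)_t\,w_\ell$ is the total weight of constraints where variable $v$ occurs positively minus the total weight of those where it occurs negatively, and $\mathrm{bias}(\Psi)=\frac1{kW}\sum_{v=1}^n|\mathrm{diff}_v(\Psi)|\in[0,1]$. **Sketching algorithm.** A streaming algorithm whose output is determined by a string (the sketch, of length $s$ = the space) produced from the input stream, such that the sketch of the concatenation of two streams can be computed from the sketches of the two component streams. **Ratio $\alpha$.** $\Delta_k$ is the set of probability distributions on $\{-1,1\}^k$ giving equal probability to vectors with the same number of $1$'s. $\mathrm{Bern}(p)$ is $1$ with probability $p$ and $-1$ with probability $1-p$. For $\mathcal D\in\Delta_k$: $\lambda_S(\mathcal D,p)=\mathbb E_{\mathbf a\sim\mathcal D,\mathbf b\sim\mathrm{Bern}(p)^k}[f_{S,k}(\mathbf a\odot\mathbf b)]$, $\mu(\mathcal D)=\mathbb E_{\mathbf b\sim\mathcal D}[b_1]$, $\beta_S(\mathcal D)=\sup_{p\in[0,1]}\lambda_S(\mathcal D,p)$, $\gamma_S(\mathcal D)=\lambda_S(\mathcal D,1)$, and $\alpha(f_{S,k})=\inf\frac{\beta_S(\mathcal D_N)}{\gamma_S(\mathcal D_Y)}$ over $\mathcal D_N,\mathcal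 D_Y\in\Delta_k$ with $\mu(\mathcal D_N)=\mu(\mathcal D_Y)$ (the ratio being $+\infty$ if $\gamma_S(\mathcal D_Y)=0$).
   Formalization: Existence of a sketch for the bias is proved for natural-number weights with known total bound (impossible in bounded-length strings for arbitrary reals); the approximation claim keeps real weights; the estimate is clipped to [-1,1] before applying γ. *)

theory Defs
  imports "HOL-Probability.Probability"
begin

section \<open>Sign vectors and symmetric predicates\<close>

text \<open>A vector of \<open>{-1,1}\<^sup>k\<close> is an integer list of length \<open>k\<close>; coordinates and variables are
  numbered from \<open>0\<close>.\<close>

definition cube :: "nat \<Rightarrow> int list set" where
  "cube k = {x. length x = k \<and> set x \<subseteq> {-1, 1}}"

definition odot :: "int list \<Rightarrow> int list \<Rightarrow> int list" (infixl "\<odot>" 70) where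
  "x \<odot> y = map2 (*) x y"

text \<open>\<open>sym_pred S\<close>, restricted to \<^term>\<open>cube k\<close>, is \<open>f_{S,k}\<close>; the arity is carried by the length of
  the argument.\<close>

definition sym_pred :: "nat set \<Rightarrow> int list \<Rightarrow> real" where
  "sym_pred S x = of_bool (count_list x 1 \<in> S)"

lemma sym_pred_threshold:
  assumes "x \<in> cube k"
  shows "sym_pred {i..k} x = (if i \<le> count_list x 1 then 1 else 0)"
  using assms count_le_length[of x 1] by (auto simp: cube_def sym_pred_def)


section \<open>The ratio alpha\<close>

definition Delta :: "nat \<Rightarrow> int list pmf set" where
  "Delta k = {D. set_pmf D \<subseteq> cube k \<and>
     (\<forall>x\<in>cube k. \<forall>y\<in>cube k. count_list x 1 = count_list y 1 \<longrightarrow> pmf D x = pmf D y)}"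

definition Bern :: "real \<Rightarrow> int pmf" where
  "Bern p = map_pmf (\<lambda>b. if b then 1 else -1) (bernoulli_pmf p)"

definition lam :: "nat \<Rightarrow> (int list \<Rightarrow> real) \<Rightarrow> int list pmf \<Rightarrow> real \<Rightarrow> real" where
  "lam k f D p =
     measure_pmf.expectation (pair_pmf D (replicate_pmf k (Bern p))) (\<lambda>(a, b). f (a \<odot> b))"

definition mu :: "int list pmf \<Rightarrow> real" where
  "mu D = measure_pmf.expectation D (\<lambda>b. of_int (b ! 0))"

definition beta :: "nat \<Rightarrow> (int list \<Rightarrow> real) \<Rightarrow> int list pmf \<Rightarrow> real" where
  "beta k f D = (SUP p\<in>{0..1}. lam k f D p)"

definition gam :: "nat \<Rightarrow> (int list \<Rightarrow> real) \<Rightarrow> int list pmf \<Rightarrow> real" where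
  "gam k f D = lam k f D 1"

definition alpha :: "nat \<Rightarrow> (int list \<Rightarrow> real) \<Rightarrow> ereal" where
  "alpha k f = Inf {(if gam k f DY = 0 then \<infinity> else ereal (beta k f DN / gam k f DY)) | DN DY.
     DN \<in> Delta k \<and> DY \<in> Delta k \<and> mu DN = mu DY}"


section \<open>Weighted Max-CSP instances\<close>

datatype csp_constraint =
  Constraint (signs: "int list") (vars: "nat list") (weight: real)

type_synonym stream = "csp_constraint list"

definition csp_streams :: "nat \<Rightarrow> nat \<Rightarrow> stream set" where
  "csp_streams k n = {\<Psi>. \<forall>c\<in>set \<Psi>. signs c \<in> cube k \<and>
     length (vars c) = k \<and> distinct (vars c) \<and> set (vars c) \<subseteq> {..<n} \<and> 0 \<le> weight c}"

definition total_weight :: "stream \<Rightarrow> real" where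
  "total_weight \<Psi> = (\<Sum>c\<leftarrow>\<Psi>. weight c)"

definition val_at :: "(int list \<Rightarrow> real) \<Rightarrow> stream \<Rightarrow> int list \<Rightarrow> real" where
  "val_at f \<Psi> \<sigma> =
     (1 / total_weight \<Psi>) * (\<Sum>c\<leftarrow>\<Psi>. weight c * f (signs c \<odot> map (\<lambda>v. \<sigma> ! v) (vars c)))"

definition csp_val :: "(int list \<Rightarrow> real) \<Rightarrow> nat \<Rightarrow> stream \<Rightarrow> real" where
  "csp_val f n \<Psi> = Max (val_at f \<Psi> ` cube n)"

definition diff :: "nat \<Rightarrow> nat \<Rightarrow> stream \<Rightarrow> real" where
  "diff k v \<Psi> = (\<Sum>c\<leftarrow>\<Psi>. \<Sum>t | t < k \<and> vars c ! t = v. of_int (signs c ! t) * weight c)"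

definition bias :: "nat \<Rightarrow> nat \<Rightarrow> stream \<Rightarrow> real" where
  "bias k n \<Psi> = (1 / (real k * total_weight \<Psi>)) * (\<Sum>v<n. \<bar>diff k v \<Psi>\<bar>)"


section \<open>Randomized sketching algorithms\<close>

text \<open>A randomized algorithm is a distribution over deterministic algorithms, a deterministic
  algorithm being a function from the input stream to the output. \<open>X\<close> is the set of admissible
  input streams. Streams of total weight \<open>0\<close> may occur as parts of an input (so sketches have to be
  defined on them), but value and bias are defined, and the guarantees are required, only for
  positive total weight.\<close>

definition sketchable :: "nat \<Rightarrow> stream set \<Rightarrow> (stream \<Rightarrow> real) \<Rightarrow> bool" where
  "sketchable s X A \<longleftrightarrow> (\<exists>(sk :: stream \<Rightarrow> bool list) comb out.
     (\<forall>\<Psi>\<in>X. length (sk \<Psi>) = s \<and> A \<Psi> = out (sk \<Psi>)) \<and>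
     (\<forall>\<Psi>\<in>X. \<forall>\<Phi>\<in>X. \<Psi> @ \<Phi> \<in> X \<longrightarrow> sk (\<Psi> @ \<Phi>) = comb (sk \<Psi>) (sk \<Phi>)))"

definition sketching_algorithm :: "nat \<Rightarrow> stream set \<Rightarrow> (stream \<Rightarrow> real) pmf \<Rightarrow> bool" where
  "sketching_algorithm s X \<A> \<longleftrightarrow> (\<forall>A\<in>set_pmf \<A>. sketchable s X A)"

definition approximates_on ::
    "real \<Rightarrow> (int list \<Rightarrow> real) \<Rightarrow> nat \<Rightarrow> stream set \<Rightarrow> (stream \<Rightarrow> real) pmf \<Rightarrow> bool" where
  "approximates_on a f n X \<A> \<longleftrightarrow> (\<forall>\<Psi>\<in>X. total_weight \<Psi> > 0 \<longrightarrow>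
     measure_pmf.prob \<A> {A. a * csp_val f n \<Psi> \<le> A \<Psi> \<and> A \<Psi> \<le> csp_val f n \<Psi>} \<ge> 2/3)"

definition estimates_bias_on ::
    "real \<Rightarrow> nat \<Rightarrow> nat \<Rightarrow> stream set \<Rightarrow> (stream \<Rightarrow> real) pmf \<Rightarrow> bool" where
  "estimates_bias_on e k n X \<A> \<longleftrightarrow> (\<forall>\<Psi>\<in>X. total_weight \<Psi> > 0 \<longrightarrow>
     measure_pmf.prob \<A> {A. (1 - e) * bias k n \<Psi> \<le> A \<Psi> \<and> A \<Psi> \<le> (1 + e) * bias k n \<Psi>} \<ge> 2/3)"

text \<open>Run the bias estimator \<open>\<A>\<close> and output \<open>g\<close> of the estimate. A multiplicative estimate of a bias
  close to \<open>1\<close> can exceed \<open>1\<close>, so it is first clipped to the domain \<open>[-1,1]\<close> of \<open>g\<close>.\<close>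

definition bias_algorithm :: "(real \<Rightarrow> real) \<Rightarrow> (stream \<Rightarrow> real) pmf \<Rightarrow> (stream \<Rightarrow> real) pmf" where
  "bias_algorithm g \<A> = map_pmf (\<lambda>A \<Psi>. g (max (-1) (min 1 (A \<Psi>)))) \<A>"

text \<open>Arbitrary real weights cannot be represented by bit strings; actual sketches are asked for on
  the usual streaming inputs, with integer weights and a known bound on the total weight.\<close>

definition integer_streams :: "nat \<Rightarrow> nat \<Rightarrow> nat \<Rightarrow> stream set" where
  "integer_streams k n M =
     {\<Psi>\<in>csp_streams k n. (\<forall>c\<in>set \<Psi>. weight c \<in> \<nat>) \<and> total_weight \<Psi> \<le> real M}"


section \<open>Piecewise linear functions\<close>

definition piecewise_linear_on :: "real \<Rightarrow> real \<Rightarrow> (real \<Rightarrow> real) \<Rightarrow> bool" where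
  "piecewise_linear_on a b g \<longleftrightarrow> (\<exists>ts. ts \<noteq> [] \<and> sorted_wrt (<) ts \<and> hd ts = a \<and> last ts = b \<and>
     (\<forall>j. Suc j < length ts \<longrightarrow> (\<exists>c d. \<forall>x\<in>{ts ! j..ts ! Suc j}. g x = c * x + d)))"

end

theory Submission
  imports Defs
begin

text \<open>
  Approximation. Put \<open>\<gamma>\<^sup>*(b) = min 1 (k(1+b)/2i)\<close>, the largest \<open>\<gamma>\<^sub>S(\<D>)\<close> over \<open>\<D> \<in> \<Delta>\<^sub>k\<close> of mean \<open>b\<close>.
  Markov's inequality for the number of satisfied literals gives \<open>val\<^sub>\<Psi> \<le> \<gamma>\<^sup>*(bias(\<Psi>))\<close>. Conversely, flip the
  variables so that every \<open>diff\<^sub>v\<close> is non-negative; the symmetrized distribution of the sign patterns of the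
  constraints then has mean \<open>bias(\<Psi>)\<close>, and independent \<open>Bern(p)\<close> assignments show that its \<open>\<beta>\<^sub>S\<close> is a lower
  bound for \<open>val\<^sub>\<Psi>\<close>, hence \<open>\<alpha> \<gamma>\<^sup>*(bias(\<Psi>)) \<le> val\<^sub>\<Psi>\<close>. So \<open>\<gamma> = \<alpha>/(1+\<epsilon>') \<gamma>\<^sup>*\<close> works.

  Sketch. The bias is the \<open>\<ell>\<^sub>1\<close>-norm of the integer vector \<open>x = (diff\<^sub>v)\<close> divided by the known number \<open>kW\<close>. For each
  scale \<open>L = 2\<^sup>j\<close> one stores a few random projections \<open>\<Sum>\<^sub>v c\<^sub>v x\<^sub>v\<close> modulo \<open>2L\<close>, where the \<open>c\<^sub>v\<close> follow a Fejer
  distribution with characteristic function \<open>1 - \<bar>m\<bar>/L\<close>. The mean cosine of the projections estimates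
  \<open>\<Prod>\<^sub>v (1 - \<bar>x\<^sub>v\<bar>/L) \<approx> 1 - \<parallel>x\<parallel>\<^sub>1/L\<close>, and any vector consistent with all these estimates has nearly the same
  norm as \<open>x\<close>, because one of the scales is a large constant multiple of the norm.
\<close>

section \<open>Expectations over finitely supported distributions\<close>

lemma integral_pmf_finite:
  fixes f :: "'a \<Rightarrow> real"
  assumes "finite (set_pmf M)"
  shows "measure_pmf.expectation M f = (\<Sum>x\<in>set_pmf M. f x * pmf M x)"
  using assms by (intro integral_measure_pmf_real) auto

lemma expectation_bind_finite:
  fixes f :: "'b \<Rightarrow> real"
  assumes "finite (set_pmf M)" "\<And>x. x \<in> set_pmf M \<Longrightarrow> finite (set_pmf (N x))"
  shows "measure_pmf.expectation (bind_pmf M N) f =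
    measure_pmf.expectation M (\<lambda>x. measure_pmf.expectation (N x) f)"
  using assms by (subst pmf_expectation_bind[of "set_pmf M"])
    (auto simp: integral_pmf_finite[of M] mult.commute)

lemma expectation_pair_finite:
  fixes f :: "'a \<times> 'b \<Rightarrow> real"
  assumes "finite (set_pmf M)" "finite (set_pmf N)"
  shows "measure_pmf.expectation (pair_pmf M N) f =
    measure_pmf.expectation M (\<lambda>x. measure_pmf.expectation N (\<lambda>y. f (x, y)))"
  unfolding pair_pmf_def using assms
  by (simp add: expectation_bind_finite)

lemma expectation_cong_pmf:
  "(\<And>x. x \<in> set_pmf M \<Longrightarrow> f x = g x) \<Longrightarrow>
    measure_pmf.expectation M f = measure_pmf.expectation M g"
  by (intro integral_cong_AE) (auto simp: AE_measure_pmf_iff)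

lemma expectation_sum_list:
  fixes f :: "'a \<Rightarrow> 'b \<Rightarrow> real"
  assumes "finite (set_pmf M)"
  shows "measure_pmf.expectation M (\<lambda>x. \<Sum>c\<leftarrow>cs. f c x) = (\<Sum>c\<leftarrow>cs. measure_pmf.expectation M (f c))"
  using assms by (induction cs) (simp_all add: integrable_measure_pmf_finite)

lemma expectation_mono_pmf:
  fixes f :: "'a \<Rightarrow> real"
  assumes "finite (set_pmf M)" "\<And>x. x \<in> set_pmf M \<Longrightarrow> f x \<le> g x"
  shows "measure_pmf.expectation M f \<le> measure_pmf.expectation M g"
  using assms by (intro integral_mono_AE) (auto simp: AE_measure_pmf_iff integrable_measure_pmf_finite)

lemma expectation_pmf_of_list:
  fixes f :: "'a \<Rightarrow> real"
  assumes wf: "pmf_of_list_wf xs"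
  shows "measure_pmf.expectation (pmf_of_list xs) f = (\<Sum>(x, w)\<leftarrow>xs. w * f x)"
proof -
  \<comment> \<open>Entries of the list may repeat and then add up. \<open>A\<close> may be any
    finite set containing the first components, so it stays fixed while the list shrinks in the
    induction.\<close>
  have *: "(\<Sum>a\<in>A. f a * sum_list (map snd (filter (\<lambda>z. fst z = a) ys))) = (\<Sum>(x, w)\<leftarrow>ys. w * f x)"
    if "finite A" "fst ` set ys \<subseteq> A" for A ys
    using that
  proof (induction ys)
    case (Cons y ys)
    have "f a * sum_list (map snd (filter (\<lambda>z. fst z = a) (y # ys))) =
      (if fst y = a then f a * snd y else 0) + f a * sum_list (map snd (filter (\<lambda>z. fst z = a) ys))" for a
      by (simp add: distrib_left)
    then show ?case
      using Cons by (simp add: sum.distrib case_prod_unfold)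
  qed simp
  have "measure_pmf.expectation (pmf_of_list xs) f = (\<Sum>a\<in>set (map fst xs). f a * pmf (pmf_of_list xs) a)"
    using set_pmf_of_list[OF wf] by (intro integral_measure_pmf_real) auto
  also have "\<dots> = (\<Sum>(x, w)\<leftarrow>xs. w * f x)"
    unfolding pmf_pmf_of_list[OF wf] by (rule *) auto
  finally show ?thesis .
qed

section \<open>Sign vectors\<close>

lemma finite_cube [simp]: "finite (cube k)"
proof -
  have "cube k = {xs. set xs \<subseteq> {-1, 1} \<and> length xs = k}" by (auto simp: cube_def)
  then show ?thesis by (simp add: finite_lists_length_eq)
qed

lemma cubeD: "x \<in> cube k \<Longrightarrow> length x = k" "x \<in> cube k \<Longrightarrow> t < k \<Longrightarrow> x ! t = -1 \<or> x ! t = 1"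
  by (auto simp: cube_def dest!: nth_mem)

lemma odot_nth: "t < length x \<Longrightarrow> t < length y \<Longrightarrow> (x \<odot> y) ! t = x ! t * y ! t"
  by (simp add: odot_def)

lemma length_odot [simp]: "length (x \<odot> y) = min (length x) (length y)"
  by (simp add: odot_def)

lemma cube_iff_nth: "x \<in> cube k \<longleftrightarrow> length x = k \<and> (\<forall>t<k. x ! t = -1 \<or> x ! t = 1)"
  by (auto simp: cube_def set_conv_nth)

lemma odot_in_cube: "x \<in> cube k \<Longrightarrow> y \<in> cube k \<Longrightarrow> x \<odot> y \<in> cube k"
  unfolding cube_iff_nth by (auto simp: odot_nth) (metis mult_minus1 mult_1 minus_minus)

lemma odot_assoc: "(x \<odot> y) \<odot> z = x \<odot> (y \<odot> z)"
  by (rule nth_equalityI) (auto simp: odot_nth)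

lemma sum_list_cube: "x \<in> cube k \<Longrightarrow> sum_list x = 2 * int (count_list x 1) - int k"
proof (induction x arbitrary: k)
  case (Cons a x)
  from Cons.prems have "x \<in> cube (length x)" "k = Suc (length x)" "a = -1 \<or> a = 1"
    by (auto simp: cube_def)
  with Cons.IH[of "length x"] show ?case by auto
qed (auto simp: cube_def)

lemma count_list_cube_le: "x \<in> cube k \<Longrightarrow> count_list x 1 \<le> k"
  using count_le_length[of x 1] by (simp add: cube_def)

text \<open>Only two values occur, so the length and the number of ones fix both multiplicities.
  Together with \<open>hit_mset\<close> this makes \<open>hit\<close> a function of the number of
  ones.\<close>

lemma mset_eq_if_cube:
  assumes "x \<in> cube k" "y \<in> cube k" "count_list x 1 = count_list y 1"
  shows "mset x = mset y"
proof -
  have *: "count_list z (-1) + count_list z 1 = length z" if "set z \<subseteq> {-1, 1}" for z :: "int list"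
    using that by (induction z) auto
  show ?thesis
  proof (rule multiset_eqI)
    fix a
    have "count_list x a = count_list y a"
    proof (cases "a \<in> {-1, 1}")
      case True
      with *[of x] *[of y] assms show ?thesis by (auto simp: cube_def)
    next
      case False
      with assms have "a \<notin> set x" "a \<notin> set y" by (auto simp: cube_def)
      then show ?thesis by simp
    qed
    then show "count (mset x) a = count (mset y) a" by (simp add: count_mset)
  qed
qed

section \<open>Independent random signs\<close>

lemma Bern_1 [simp]: "Bern 1 = return_pmf 1"
proof -
  have "bernoulli_pmf 1 = return_pmf True"
    by (rule pmf_eqI) (auto simp: indicator_def split: bool.splits; case_tac i; simp)
  then show ?thesis by (simp add: Bern_def)
qed

lemma set_pmf_Bern: "set_pmf (Bern p) \<subseteq> {-1, 1}"
  by (auto simp: Bern_def)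

lemma set_pmf_replicate_Bern: "set_pmf (replicate_pmf k (Bern p)) \<subseteq> cube k"
  using set_pmf_Bern[of p] by (auto simp: set_replicate_pmf cube_def)

lemma finite_set_pmf_replicate_Bern [simp]: "finite (set_pmf (replicate_pmf k (Bern p)))"
  using finite_subset[OF set_pmf_replicate_Bern] by simp

lemma replicate_pmf_return: "replicate_pmf k (return_pmf x) = return_pmf (replicate k x)"
  by (induction k) (auto simp: bind_return_pmf)

lemma odot_ones: "a \<odot> replicate (length a) 1 = a"
  by (rule nth_equalityI) (auto simp: odot_nth)

section \<open>Products of a fixed sign vector with independent random signs\<close>

text \<open>For signs, an entry of the product is 1 exactly where the two vectors agree. Passing to
  the law of the number of agreements hides the order of the coordinates.\<close>

definition match_pmf :: "int pmf \<Rightarrow> int list \<Rightarrow> nat pmf" where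
  "match_pmf q a = map_pmf (\<lambda>b. count_list (a \<odot> b) 1) (replicate_pmf (length a) q)"

lemma match_pmf_Cons:
  "match_pmf q (x # a) =
    bind_pmf q (\<lambda>y. bind_pmf (match_pmf q a) (\<lambda>c. return_pmf (of_bool (x * y = 1) + c)))"
proof -
  have *: "count_list ((x # a) \<odot> (y # b)) 1 = of_bool (x * y = 1) + count_list (a \<odot> b) 1" for y b
    by (simp add: odot_def)
  have "match_pmf q (x # a) = bind_pmf q (\<lambda>y. bind_pmf (replicate_pmf (length a) q)
      (\<lambda>b. return_pmf (of_bool (x * y = 1) + count_list (a \<odot> b) 1)))"
    by (simp add: match_pmf_def map_bind_pmf *)
  also have "\<dots> = bind_pmf q (\<lambda>y. bind_pmf (match_pmf q a) (\<lambda>c. return_pmf (of_bool (x * y = 1) + c)))"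
    by (simp add: match_pmf_def bind_map_pmf)
  finally show ?thesis .
qed

text \<open>By \<open>match_pmf_Cons\<close> every coordinate contributes an independent summand,
  and independent draws may be exchanged.\<close>

lemma match_pmf_insert: "match_pmf q (us @ x # vs) = match_pmf q (x # us @ vs)"
proof (induction us)
  case (Cons u us)
  show ?case
    by (simp add: Cons match_pmf_Cons bind_assoc_pmf bind_return_pmf)
      (subst bind_commute_pmf, simp add: add.left_commute)
qed simp

lemma match_pmf_mset: "mset a = mset a' \<Longrightarrow> match_pmf q a = match_pmf q a'"
proof (induction a arbitrary: a')
  case (Cons x a)
  then have "x \<in> set a'" by (metis list.set_intros(1) mset_eq_setD)
  then obtain us vs where a': "a' = us @ x # vs" by (meson split_list)
  with Cons.prems have "mset a = mset (us @ vs)" by simp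
  then have "match_pmf q a = match_pmf q (us @ vs)" by (rule Cons.IH)
  then show ?case
    unfolding a' match_pmf_insert by (simp add: match_pmf_Cons)
qed simp

text \<open>The inner expectation of \<open>lam\<close> for a fixed pattern \<open>a\<close>;
  \<open>lam_eq_hit\<close> recovers \<open>lam\<close> by averaging over the pattern.\<close>

definition hit :: "nat set \<Rightarrow> real \<Rightarrow> int list \<Rightarrow> real" where
  "hit S p a = measure_pmf.expectation (replicate_pmf (length a) (Bern p)) (\<lambda>b. sym_pred S (a \<odot> b))"

lemma hit_eq_match_pmf:
  "hit S p a = measure_pmf.expectation (match_pmf (Bern p) a) (\<lambda>c. of_bool (c \<in> S))"
  by (simp only: hit_def match_pmf_def integral_map_pmf sym_pred_def)

lemma hit_mset: "mset a = mset a' \<Longrightarrow> hit S p a = hit S p a'"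
  by (simp only: hit_eq_match_pmf match_pmf_mset[of a a'])

lemma hit_range: "hit S p a \<in> {0..1}"
proof -
  have "hit S p a \<le> measure_pmf.expectation (replicate_pmf (length a) (Bern p)) (\<lambda>_. 1)"
    unfolding hit_def by (rule expectation_mono_pmf) (auto simp: sym_pred_def)
  moreover have "0 \<le> hit S p a"
    unfolding hit_def by (rule integral_nonneg_AE) (auto simp: sym_pred_def)
  ultimately show ?thesis by simp
qed

section \<open>The functionals \<open>lam\<close>, \<open>gam\<close> and \<open>beta\<close> on
  \<open>Delta\<close>\<close>

lemma set_pmf_Delta: "D \<in> Delta k \<Longrightarrow> x \<in> set_pmf D \<Longrightarrow> x \<in> cube k"
  unfolding Delta_def by blast

lemma pmf_Delta:
  "D \<in> Delta k \<Longrightarrow> x \<in> cube k \<Longrightarrow> y \<in> cube k \<Longrightarrow> count_list x 1 = count_list y 1 \<Longrightarrow>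
    pmf D x = pmf D y"
  unfolding Delta_def by blast

lemma finite_set_pmf_Delta: "D \<in> Delta k \<Longrightarrow> finite (set_pmf D)"
  by (rule finite_subset[OF _ finite_cube[of k]]) (auto dest: set_pmf_Delta)

lemma lam_eq_hit:
  assumes "D \<in> Delta k"
  shows "lam k (sym_pred S) D p = measure_pmf.expectation D (hit S p)"
proof -
  have "lam k (sym_pred S) D p = measure_pmf.expectation D
      (\<lambda>a. measure_pmf.expectation (replicate_pmf k (Bern p)) (\<lambda>b. sym_pred S (a \<odot> b)))"
    unfolding lam_def using finite_set_pmf_Delta[OF assms] by (subst expectation_pair_finite) auto
  also have "\<dots> = measure_pmf.expectation D (hit S p)"
    by (rule expectation_cong_pmf) (use set_pmf_Delta[OF assms] in \<open>simp add: hit_def cube_def\<close>)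
  finally show ?thesis .
qed

lemma lam_range: "D \<in> Delta k \<Longrightarrow> lam k (sym_pred S) D p \<in> {0..1}"
proof -
  assume D: "D \<in> Delta k"
  have "measure_pmf.expectation D (hit S p) \<le> measure_pmf.expectation D (\<lambda>_. 1)"
    by (rule expectation_mono_pmf) (use hit_range D in \<open>auto intro: finite_set_pmf_Delta\<close>)
  moreover have "0 \<le> measure_pmf.expectation D (hit S p)"
    by (rule integral_nonneg_AE) (use hit_range in auto)
  ultimately show ?thesis by (simp add: lam_eq_hit[OF D])
qed

lemma gam_eq:
  assumes "D \<in> Delta k"
  shows "gam k (sym_pred S) D = measure_pmf.expectation D (sym_pred S)"
  unfolding gam_def lam_eq_hit[OF assms]
  by (rule expectation_cong_pmf) (simp add: hit_def replicate_pmf_return odot_ones)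

lemma beta_bounds:
  assumes "D \<in> Delta k"
  shows "gam k (sym_pred S) D \<le> beta k (sym_pred S) D" "0 \<le> beta k (sym_pred S) D"
proof -
  have "bdd_above (lam k (sym_pred S) D ` {0..1})"
    using lam_range[OF assms] by (intro bdd_aboveI[of _ 1]) auto
  then show "gam k (sym_pred S) D \<le> beta k (sym_pred S) D"
    unfolding beta_def gam_def by (intro cSUP_upper) auto
  moreover have "0 \<le> gam k (sym_pred S) D"
    unfolding gam_def using lam_range[OF assms] by auto
  ultimately show "0 \<le> beta k (sym_pred S) D" by linarith
qed

section \<open>Symmetric distributions\<close>

definition level :: "nat \<Rightarrow> nat \<Rightarrow> int list set" where
  "level k c = {x \<in> cube k. count_list x 1 = c}"

text \<open>A symmetric distribution is encoded by the law \<open>N\<close> of its number of ones,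
  and expectations of symmetric functions only see \<open>N\<close>. Levels above \<open>k\<close>
  are empty, hence the support condition on \<open>N\<close> in the lemmas.\<close>

definition sym_pmf :: "nat \<Rightarrow> nat pmf \<Rightarrow> int list pmf" where
  "sym_pmf k N = bind_pmf N (\<lambda>c. pmf_of_set (level k c))"

lemma finite_level [simp]: "finite (level k c)"
  by (simp add: level_def)

lemma level_nonempty: "c \<le> k \<Longrightarrow> level k c \<noteq> {}"
proof -
  assume "c \<le> k"
  moreover have "count_list (replicate m (1::int)) 1 = m" "count_list (replicate m (-1::int)) 1 = 0" for m
    by (induction m) auto
  ultimately have "replicate c 1 @ replicate (k - c) (-1) \<in> level k c"
    by (auto simp: level_def cube_def)
  then show ?thesis by auto
qed

lemma set_sym_pmf: "set_pmf N \<subseteq> {..k} \<Longrightarrow> set_pmf (sym_pmf k N) \<subseteq> cube k"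
  using level_nonempty by (auto simp: sym_pmf_def level_def)

lemma sym_pmf_in_Delta:
  assumes "set_pmf N \<subseteq> {..k}"
  shows "sym_pmf k N \<in> Delta k"
proof -
  have "pmf (sym_pmf k N) x = pmf (sym_pmf k N) y"
    if "x \<in> cube k" "y \<in> cube k" "count_list x 1 = count_list y 1" for x y
    unfolding sym_pmf_def pmf_bind
  proof (rule expectation_cong_pmf)
    fix c assume "c \<in> set_pmf N"
    with assms have "level k c \<noteq> {}" by (intro level_nonempty) auto
    with that show "pmf (pmf_of_set (level k c)) x = pmf (pmf_of_set (level k c)) y"
      by (simp add: indicator_def level_def)
  qed
  with set_sym_pmf[OF assms] show ?thesis unfolding Delta_def by blast
qed

lemma map_sym_pmf:
  assumes "set_pmf N \<subseteq> {..k}"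
  shows "map_pmf (\<lambda>x. count_list x 1) (sym_pmf k N) = N"
proof -
  have "map_pmf (\<lambda>x. count_list x 1) (sym_pmf k N) =
      bind_pmf N (\<lambda>c. map_pmf (\<lambda>x. count_list x 1) (pmf_of_set (level k c)))"
    by (simp add: sym_pmf_def map_bind_pmf)
  also have "\<dots> = bind_pmf N return_pmf"
  proof (rule bind_pmf_cong[OF refl])
    fix c assume "c \<in> set_pmf N"
    with assms have "level k c \<noteq> {}" by (intro level_nonempty) auto
    then have "map_pmf (\<lambda>x. count_list x 1) (pmf_of_set (level k c)) =
        map_pmf (\<lambda>_. c) (pmf_of_set (level k c))"
      by (intro map_pmf_cong) (auto simp: level_def)
    then show "map_pmf (\<lambda>x. count_list x 1) (pmf_of_set (level k c)) = return_pmf c" by simp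
  qed
  also have "\<dots> = N" by (rule bind_return_pmf')
  finally show ?thesis .
qed

lemma expectation_sym_pmf:
  fixes f :: "int list \<Rightarrow> real" and g :: "nat \<Rightarrow> real"
  assumes "set_pmf N \<subseteq> {..k}" "\<And>x. x \<in> cube k \<Longrightarrow> f x = g (count_list x 1)"
  shows "measure_pmf.expectation (sym_pmf k N) f = measure_pmf.expectation N g"
proof -
  have "measure_pmf.expectation (sym_pmf k N) f =
      measure_pmf.expectation (sym_pmf k N) (\<lambda>x. g (count_list x 1))"
    using set_sym_pmf[OF assms(1)] assms(2) by (intro expectation_cong_pmf) auto
  also have "\<dots> = measure_pmf.expectation (map_pmf (\<lambda>x. count_list x 1) (sym_pmf k N)) g" by simp
  finally show ?thesis by (simp only: map_sym_pmf[OF assms(1)])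
qed

text \<open>Exchanging the entries \<open>0\<close> and \<open>t\<close> is an involution of the
  cube that keeps the number of ones, hence preserves \<open>pmf D\<close>. So the coordinate
  singled out in \<open>mu\<close> is not special.\<close>

lemma expectation_coordinate_Delta:
  assumes D: "D \<in> Delta k" and t: "t < k"
  shows "measure_pmf.expectation D (\<lambda>x. real_of_int (x ! t)) = mu D"
proof -
  define sw where "sw = (\<lambda>x :: int list. x[0 := x ! t, t := x ! 0])"
  have mset: "mset (sw x) = mset x" if "x \<in> cube k" for x
    using mset_swap[of t x 0] that t by (cases "x = []") (auto simp: sw_def cube_def)
  have cube: "sw x \<in> cube k" if "x \<in> cube k" for x
    using mset_eq_setD[OF mset[OF that]] that by (simp add: cube_def) (simp add: sw_def)
  have count: "count_list (sw x) 1 = count_list x 1" if "x \<in> cube k" for x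
    using arg_cong[OF mset[OF that], of "\<lambda>m. count m 1"] by (simp only: count_mset)
  have inv: "sw (sw x) = x" if "x \<in> cube k" for x
    using that t by (intro nth_equalityI) (auto simp: sw_def nth_list_update cube_def)
  have sub: "set_pmf D \<subseteq> cube k" using set_pmf_Delta[OF D] by blast
  have "measure_pmf.expectation D (\<lambda>x. real_of_int (x ! t)) = (\<Sum>x\<in>cube k. real_of_int (x ! t) * pmf D x)"
    using sub by (intro integral_measure_pmf_real) auto
  also have "\<dots> = (\<Sum>x\<in>cube k. real_of_int (x ! 0) * pmf D x)"
  proof (rule sum.reindex_bij_witness[of _ sw sw])
    fix x assume x: "x \<in> cube k"
    have "pmf D (sw x) = pmf D x"
      by (rule pmf_Delta[OF D cube[OF x] x count[OF x]])
    moreover have "sw x ! 0 = x ! t" using t x by (auto simp: sw_def cube_def nth_list_update)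
    ultimately show "real_of_int (sw x ! 0) * pmf D (sw x) = real_of_int (x ! t) * pmf D x" by simp
  qed (auto simp: inv cube)
  also have "\<dots> = mu D"
    unfolding mu_def using sub by (intro integral_measure_pmf_real[symmetric]) auto
  finally show ?thesis .
qed

lemma mu_eq_sum_list:
  assumes D: "D \<in> Delta k"
  shows "real k * mu D = measure_pmf.expectation D (\<lambda>x. real_of_int (sum_list x))"
proof -
  have "measure_pmf.expectation D (\<lambda>x. real_of_int (sum_list x)) =
      measure_pmf.expectation D (\<lambda>x. \<Sum>t<k. real_of_int (x ! t))"
    using set_pmf_Delta[OF D] by (intro expectation_cong_pmf)
      (simp add: cube_def sum_list_sum_nth atLeast0LessThan)
  also have "\<dots> = (\<Sum>t<k. mu D)"
    using finite_set_pmf_Delta[OF D] expectation_coordinate_Delta[OF D]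
    by (subst Bochner_Integration.integral_sum) (auto simp: integrable_measure_pmf_finite)
  finally show ?thesis by simp
qed

lemma mu_sym_pmf:
  assumes "set_pmf N \<subseteq> {..k}"
  shows "real k * mu (sym_pmf k N) = measure_pmf.expectation N (\<lambda>c. 2 * real c - real k)"
  unfolding mu_eq_sum_list[OF sym_pmf_in_Delta[OF assms]]
  by (rule expectation_sym_pmf[OF assms]) (simp add: sum_list_cube)

lemma gam_sym_pmf:
  assumes "set_pmf N \<subseteq> {..k}"
  shows "gam k (sym_pred S) (sym_pmf k N) = measure_pmf.expectation N (\<lambda>c. of_bool (c \<in> S))"
  unfolding gam_eq[OF sym_pmf_in_Delta[OF assms]]
  by (rule expectation_sym_pmf[OF assms]) (simp add: sym_pred_def)

section \<open>The value of an instance in terms of its bias\<close>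

text \<open>The argument that the predicate receives under the assignment \<open>s\<close>; equally,
  the literal signs after flipping the variables with \<open>s v = -1\<close>. Assignments are
  functions here, so that two of them can be multiplied.\<close>

definition orient :: "(nat \<Rightarrow> int) \<Rightarrow> csp_constraint \<Rightarrow> int list" where
  "orient s c = signs c \<odot> map s (vars c)"

lemma csp_streamsD:
  assumes "\<Psi> \<in> csp_streams k n" "c \<in> set \<Psi>"
  shows "signs c \<in> cube k" "length (vars c) = k" "distinct (vars c)" "set (vars c) \<subseteq> {..<n}" "0 \<le> weight c"
  using assms by (auto simp: csp_streams_def)

lemma orient_in_cube:
  assumes "\<Psi> \<in> csp_streams k n" "c \<in> set \<Psi>" "\<And>v. v < n \<Longrightarrow> s v = -1 \<or> s v = 1"
  shows "orient s c \<in> cube k"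
  unfolding orient_def
proof (rule odot_in_cube)
  show "map s (vars c) \<in> cube k"
    using csp_streamsD[OF assms(1,2)] assms(3) by (auto simp: cube_def)
qed (rule csp_streamsD[OF assms(1,2)])

text \<open>Double counting: every position of a constraint is charged to the variable standing
  there.\<close>

lemma weighted_sum_orient:
  assumes "\<Psi> \<in> csp_streams k n"
  shows "(\<Sum>c\<leftarrow>\<Psi>. weight c * real_of_int (sum_list (orient s c))) = (\<Sum>v<n. real_of_int (s v) * diff k v \<Psi>)"
  using assms
proof (induction \<Psi>)
  case (Cons c \<Psi>)
  note c = csp_streamsD[OF Cons.prems list.set_intros(1)]
  let ?g = "\<lambda>t. real_of_int (s (vars c ! t)) * (of_int (signs c ! t) * weight c)"
  have "(\<Sum>v<n. real_of_int (s v) * (\<Sum>t | t < k \<and> vars c ! t = v. of_int (signs c ! t) * weight c)) =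
      (\<Sum>v<n. \<Sum>t | t \<in> {..<k} \<and> vars c ! t = v. ?g t)"
    by (intro sum.cong) (auto simp: sum_distrib_left intro!: sum.cong)
  also have "\<dots> = (\<Sum>t<k. ?g t)"
    using c by (intro sum.group) (auto simp: subset_iff)
  also have "\<dots> = weight c * real_of_int (\<Sum>t<k. signs c ! t * s (vars c ! t))"
    by (simp add: sum_distrib_left mult_ac)
  also have "(\<Sum>t<k. signs c ! t * s (vars c ! t)) = sum_list (orient s c)"
    using c cubeD(1)[OF c(1)] unfolding orient_def
    by (simp add: sum_list_sum_nth atLeast0LessThan odot_nth)
  finally have "(\<Sum>v<n. real_of_int (s v) * (\<Sum>t | t < k \<and> vars c ! t = v. of_int (signs c ! t) * weight c)) =
      weight c * real_of_int (sum_list (orient s c))" .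
  moreover have "\<Psi> \<in> csp_streams k n" using Cons.prems by (simp add: csp_streams_def)
  ultimately show ?case
    using Cons.IH by (simp add: diff_def distrib_left sum.distrib)
qed (simp add: diff_def)

definition majority :: "nat \<Rightarrow> stream \<Rightarrow> nat \<Rightarrow> int" where
  "majority k \<Psi> v = (if 0 \<le> diff k v \<Psi> then 1 else -1)"

lemma majority_cases: "majority k \<Psi> v = -1 \<or> majority k \<Psi> v = 1"
  by (simp add: majority_def)

text \<open>The majority signs turn every \<open>diff\<close> into its absolute value, so the double
  count yields the numerator of the bias.\<close>

lemma bias_eq_majority:
  assumes "\<Psi> \<in> csp_streams k n"
  shows "bias k n \<Psi> = (\<Sum>c\<leftarrow>\<Psi>. weight c * real_of_int (sum_list (orient (majority k \<Psi>) c)))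
    / (real k * total_weight \<Psi>)"
  unfolding weighted_sum_orient[OF assms] bias_def
  by (simp add: majority_def sum_divide_distrib mult.commute) (intro sum.cong, auto)

lemma sum_list_weight_mono:
  fixes f g :: "csp_constraint \<Rightarrow> real"
  assumes "\<Psi> \<in> csp_streams k n" "\<And>c. c \<in> set \<Psi> \<Longrightarrow> f c \<le> g c"
  shows "(\<Sum>c\<leftarrow>\<Psi>. weight c * f c) \<le> (\<Sum>c\<leftarrow>\<Psi>. weight c * g c)"
  using assms(2) csp_streamsD(5)[OF assms(1)] by (intro sum_list_mono mult_left_mono) auto

lemma sum_list_weight_const: "(\<Sum>c\<leftarrow>\<Psi>. weight c * (a :: real)) = total_weight \<Psi> * a"
  by (simp add: total_weight_def sum_list_mult_const)

lemma sum_list_weight_affine: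
  fixes f :: "csp_constraint \<Rightarrow> real"
  shows "(\<Sum>c\<leftarrow>\<Psi>. weight c * ((a + f c) / d)) = (total_weight \<Psi> * a + (\<Sum>c\<leftarrow>\<Psi>. weight c * f c)) / d"
  by (induction \<Psi>) (simp_all add: total_weight_def distrib_left distrib_right add_divide_distrib)

lemma bias_range:
  assumes \<Psi>: "\<Psi> \<in> csp_streams k n" and W: "total_weight \<Psi> > 0" and k: "k \<ge> 1"
  shows "0 \<le> bias k n \<Psi>" "bias k n \<Psi> \<le> 1"
proof -
  show "0 \<le> bias k n \<Psi>" using W by (simp add: bias_def sum_nonneg)
  have "(\<Sum>c\<leftarrow>\<Psi>. weight c * real_of_int (sum_list (orient (majority k \<Psi>) c))) \<le> (\<Sum>c\<leftarrow>\<Psi>. weight c * real k)"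
  proof (rule sum_list_weight_mono[OF \<Psi>])
    fix c assume "c \<in> set \<Psi>"
    from orient_in_cube[OF \<Psi> this] majority_cases
    have "orient (majority k \<Psi>) c \<in> cube k" by blast
    from sum_list_cube[OF this] count_list_cube_le[OF this]
    show "real_of_int (sum_list (orient (majority k \<Psi>) c)) \<le> real k" by simp
  qed
  then show "bias k n \<Psi> \<le> 1"
    using W k unfolding bias_eq_majority[OF \<Psi>] sum_list_weight_const
    by (simp add: mult.commute)
qed

section \<open>Upper bound on the value: Markov's inequality\<close>

definition gamma_star :: "nat \<Rightarrow> nat \<Rightarrow> real \<Rightarrow> real" where
  "gamma_star k i b = min 1 (real k * (1 + b) / (2 * real i))"

lemma val_at_eq_orient:
  assumes "\<Psi> \<in> csp_streams k n"
  shows "val_at f \<Psi> (map s [0..<n]) = (\<Sum>c\<leftarrow>\<Psi>. weight c * f (orient s c)) / total_weight \<Psi>"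
proof -
  have "map (\<lambda>v. map s [0..<n] ! v) (vars c) = map s (vars c)" if "c \<in> set \<Psi>" for c
    using csp_streamsD(4)[OF assms that] by auto
  then have "weight c * f (signs c \<odot> map (\<lambda>v. map s [0..<n] ! v) (vars c)) = weight c * f (orient s c)"
    if "c \<in> set \<Psi>" for c
    using that by (simp only: orient_def)
  then have "(\<Sum>c\<leftarrow>\<Psi>. weight c * f (signs c \<odot> map (\<lambda>v. map s [0..<n] ! v) (vars c))) =
      (\<Sum>c\<leftarrow>\<Psi>. weight c * f (orient s c))"
    by (intro arg_cong[of _ _ sum_list] map_cong refl)
  then show ?thesis by (simp add: val_at_def)
qed

lemma csp_val_le_gamma_star:
  assumes \<Psi>: "\<Psi> \<in> csp_streams k n" and W: "total_weight \<Psi> > 0" and i: "1 \<le> i" "i \<le> k"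
  shows "csp_val (sym_pred {i..k}) n \<Psi> \<le> gamma_star k i (bias k n \<Psi>)"
proof -
  have "val_at (sym_pred {i..k}) \<Psi> \<sigma> \<le> gamma_star k i (bias k n \<Psi>)" if \<sigma>: "\<sigma> \<in> cube n" for \<sigma>
  proof -
    define s where "s = (\<lambda>v. \<sigma> ! v)"
    have s: "s v = -1 \<or> s v = 1" if "v < n" for v
      using cubeD(2)[OF \<sigma> that] by (simp add: s_def)
    have \<sigma>_eq: "\<sigma> = map s [0..<n]"
      using cubeD(1)[OF \<sigma>] by (auto simp: s_def intro: nth_equalityI)
    note val = val_at_eq_orient[OF \<Psi>, of "sym_pred {i..k}" s, folded \<sigma>_eq]
    have "(\<Sum>c\<leftarrow>\<Psi>. weight c * sym_pred {i..k} (orient s c)) \<le> (\<Sum>c\<leftarrow>\<Psi>. weight c * 1)"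
      by (rule sum_list_weight_mono[OF \<Psi>]) (simp add: sym_pred_def)
    then have 1: "val_at (sym_pred {i..k}) \<Psi> \<sigma> \<le> 1"
      using W by (simp add: val total_weight_def)
    \<comment> \<open>Markov's inequality constraint by constraint: the number of ones is half of
      \<open>k\<close> plus the sum of the signs, and the indicator of having at least
      \<open>i\<close> ones is at most this number divided by \<open>i\<close>.\<close>
    have "(\<Sum>c\<leftarrow>\<Psi>. weight c * sym_pred {i..k} (orient s c)) \<le>
        (\<Sum>c\<leftarrow>\<Psi>. weight c * ((real k + real_of_int (sum_list (orient s c))) / (2 * real i)))"
    proof (rule sum_list_weight_mono[OF \<Psi>])
      fix c assume "c \<in> set \<Psi>"
      from orient_in_cube[OF \<Psi> this] s have "orient s c \<in> cube k" by blast
      from sum_list_cube[OF this]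
      show "sym_pred {i..k} (orient s c) \<le> (real k + real_of_int (sum_list (orient s c))) / (2 * real i)"
        using i by (auto simp: sym_pred_def field_simps)
    qed
    also have "\<dots> = (total_weight \<Psi> * real k + (\<Sum>c\<leftarrow>\<Psi>. weight c * real_of_int (sum_list (orient s c)))) / (2 * real i)"
      by (rule sum_list_weight_affine)
    \<comment> \<open>No assignment beats the majority signs for the literal sum.\<close>
    also have "(\<Sum>c\<leftarrow>\<Psi>. weight c * real_of_int (sum_list (orient s c))) \<le> (\<Sum>v<n. \<bar>diff k v \<Psi>\<bar>)"
      unfolding weighted_sum_orient[OF \<Psi>]
    proof (rule sum_mono)
      fix v assume "v \<in> {..<n}"
      with s[of v] show "real_of_int (s v) * diff k v \<Psi> \<le> \<bar>diff k v \<Psi>\<bar>" by auto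
    qed
    also have "(\<Sum>v<n. \<bar>diff k v \<Psi>\<bar>) = total_weight \<Psi> * real k * bias k n \<Psi>"
      using W i by (simp add: bias_def)
    finally have "val_at (sym_pred {i..k}) \<Psi> \<sigma> \<le> real k * (1 + bias k n \<Psi>) / (2 * real i)"
      using W i by (simp add: val field_simps)
    with 1 show ?thesis by (simp add: gamma_star_def)
  qed
  moreover have "cube n \<noteq> {}" using level_nonempty[of 0 n] by (auto simp: level_def)
  ultimately show ?thesis unfolding csp_val_def by (subst Max_le_iff) auto
qed

section \<open>Lower bound on the value: random assignments\<close>

lemma map_Pi_pmf_distinct:
  assumes "distinct js" "set js \<subseteq> A" "finite A"
  shows "map_pmf (\<lambda>\<tau>. map \<tau> js) (Pi_pmf A d (\<lambda>_. q)) = replicate_pmf (length js) q"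
  using assms
proof (induction js arbitrary: A)
  case (Cons j js)
  have A: "A = insert j (A - {j})" using Cons.prems by auto
  have "map_pmf (\<lambda>\<tau>. map \<tau> (j # js)) (Pi_pmf A d (\<lambda>_. q)) =
      bind_pmf q (\<lambda>y. map_pmf (\<lambda>\<tau>. y # map (\<tau>(j := y)) js) (Pi_pmf (A - {j}) d (\<lambda>_. q)))"
    by (subst A, subst Pi_pmf_insert') (use Cons.prems in \<open>auto simp: map_bind_pmf map_pmf_def bind_assoc_pmf bind_return_pmf\<close>)
  \<comment> \<open>By distinctness \<open>j\<close> does not occur in \<open>js\<close>, so
    overwriting the value at \<open>j\<close> leaves the remaining entries alone.\<close>
  also have "\<dots> = bind_pmf q (\<lambda>y. map_pmf (\<lambda>ys. y # ys) (map_pmf (\<lambda>\<tau>. map \<tau> js) (Pi_pmf (A - {j}) d (\<lambda>_. q))))"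
    unfolding pmf.map_comp
    by (intro bind_pmf_cong map_pmf_cong) (use Cons.prems in \<open>auto simp: map_fun_upd\<close>)
  also have "map_pmf (\<lambda>\<tau>. map \<tau> js) (Pi_pmf (A - {j}) d (\<lambda>_. q)) = replicate_pmf (length js) q"
    using Cons.prems by (intro Cons.IH) auto
  finally show ?case by (simp add: map_pmf_def)
qed simp

text \<open>The law of the number of literals satisfied by \<open>s\<close> in a constraint drawn
  with probability proportional to its weight.\<close>

definition count_pmf :: "(nat \<Rightarrow> int) \<Rightarrow> stream \<Rightarrow> nat pmf" where
  "count_pmf s \<Psi> = pmf_of_list (map (\<lambda>c. (count_list (orient s c) 1, weight c / total_weight \<Psi>)) \<Psi>)"

lemma count_pmf_wf:
  assumes \<Psi>: "\<Psi> \<in> csp_streams k n" and W: "total_weight \<Psi> > 0"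
  shows "pmf_of_list_wf (map (\<lambda>c. (count_list (orient s c) 1, weight c / total_weight \<Psi>)) \<Psi>)"
proof (rule pmf_of_list_wfI)
  show "0 \<le> x" if "x \<in> set (map snd (map (\<lambda>c. (count_list (orient s c) 1, weight c / total_weight \<Psi>)) \<Psi>))" for x
    using that W csp_streamsD(5)[OF \<Psi>] by auto
  have "(\<Sum>c\<leftarrow>\<Psi>. weight c / total_weight \<Psi>) = 1"
    using W sum_list_mult_const[of weight "1 / total_weight \<Psi>" \<Psi>]
    by (simp add: total_weight_def)
  then show "sum_list (map snd (map (\<lambda>c. (count_list (orient s c) 1, weight c / total_weight \<Psi>)) \<Psi>)) = 1"
    by (simp add: o_def)
qed

lemma expectation_count_pmf:
  assumes \<Psi>: "\<Psi> \<in> csp_streams k n" and W: "total_weight \<Psi> > 0"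
  shows "measure_pmf.expectation (count_pmf s \<Psi>) g =
    (\<Sum>c\<leftarrow>\<Psi>. weight c * g (count_list (orient s c) 1)) / total_weight \<Psi>"
  unfolding count_pmf_def expectation_pmf_of_list[OF count_pmf_wf[OF assms]]
  using sum_list_weight_affine[of 0 "\<lambda>c. g (count_list (orient s c) 1)" "total_weight \<Psi>" \<Psi>]
  by (simp add: o_def)

lemma set_count_pmf:
  assumes \<Psi>: "\<Psi> \<in> csp_streams k n" and W: "total_weight \<Psi> > 0" and s: "\<And>v. s v = -1 \<or> s v = 1"
  shows "set_pmf (count_pmf s \<Psi>) \<subseteq> {..k}"
proof
  fix x assume "x \<in> set_pmf (count_pmf s \<Psi>)"
  then obtain c where "c \<in> set \<Psi>" "x = count_list (orient s c) 1"
    using set_pmf_of_list[OF count_pmf_wf[OF \<Psi> W, of s]] by (auto simp: count_pmf_def)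
  with count_list_cube_le[OF orient_in_cube[OF \<Psi> _ s]] show "x \<in> {..k}" by auto
qed

text \<open>Give variable \<open>v\<close> the sign \<open>s v\<close> times an independent
  \<open>Bern p\<close> sign. Each constraint is then satisfied with probability \<open>hit\<close>
  of its oriented pattern, so the expected value of the instance is \<open>lam\<close>, and the
  maximum is at least the expectation.\<close>

lemma lam_count_pmf_le_csp_val:
  assumes \<Psi>: "\<Psi> \<in> csp_streams k n" and W: "total_weight \<Psi> > 0" and s: "\<And>v. s v = -1 \<or> s v = 1"
  shows "lam k (sym_pred S) (sym_pmf k (count_pmf s \<Psi>)) p \<le> csp_val (sym_pred S) n \<Psi>"
proof -
  let ?N = "count_pmf s \<Psi>" and ?f = "sym_pred S"
  \<comment> \<open>An arbitrary vector with \<open>c\<close> ones; it rewrites \<open>hit\<close>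
    as a function of the count, the form that \<open>expectation_sym_pmf\<close> asks for.\<close>
  define rep where "rep c = (SOME x. x \<in> level k c)" for c
  have N: "set_pmf ?N \<subseteq> {..k}" using \<Psi> W s by (rule set_count_pmf)
  have orient_cube: "orient s c \<in> cube k" if "c \<in> set \<Psi>" for c
    using \<Psi> that s by (rule orient_in_cube)
  have hit: "hit S p x = hit S p (rep (count_list x 1))" if "x \<in> cube k" for x
  proof (rule hit_mset, rule mset_eq_if_cube)
    have "rep (count_list x 1) \<in> level k (count_list x 1)"
      unfolding rep_def some_in_eq using count_list_cube_le[OF that] by (rule level_nonempty)
    then show "rep (count_list x 1) \<in> cube k" "count_list x 1 = count_list (rep (count_list x 1)) 1"
      unfolding level_def by auto
  qed fact
  \<comment> \<open>The default 1 outside \<open>{..<n}\<close> keeps \<open>\<tau> v\<close> a sign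
    for every \<open>v\<close>.\<close>
  define P where "P = Pi_pmf {..<n} (1 :: int) (\<lambda>_. Bern p)"
  have set_P: "\<tau> v = -1 \<or> \<tau> v = 1" if "\<tau> \<in> set_pmf P" for \<tau> v
    using that set_pmf_Bern[of p] set_Pi_pmf_subset'[of "{..<n}" 1 "\<lambda>_. Bern p"]
    by (cases "v < n") (auto simp: P_def PiE_dflt_def)
  have fin: "finite (set_pmf P)"
  proof (rule finite_subset)
    show "set_pmf P \<subseteq> PiE_dflt {..<n} 1 (set_pmf \<circ> (\<lambda>_. Bern p))"
      unfolding P_def by (rule set_Pi_pmf_subset') simp
    show "finite (PiE_dflt {..<n} 1 (set_pmf \<circ> (\<lambda>_. Bern p)))"
      using finite_subset[OF set_pmf_Bern[of p]] by (intro finite_PiE_dflt) auto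
  qed
  have orient_mult: "orient (\<lambda>v. s v * \<tau> v) c = orient s c \<odot> map \<tau> (vars c)" if "c \<in> set \<Psi>" for c \<tau>
    unfolding orient_def odot_assoc by (intro arg_cong[of _ _ "\<lambda>y. _ \<odot> y"] nth_equalityI) (auto simp: odot_nth)
  have E: "measure_pmf.expectation P (\<lambda>\<tau>. ?f (orient (\<lambda>v. s v * \<tau> v) c)) = hit S p (orient s c)"
    if c: "c \<in> set \<Psi>" for c
  proof -
    note cD = csp_streamsD[OF \<Psi> c]
    have len: "length (orient s c) = length (vars c)"
      using cD cubeD(1)[OF cD(1)] by (simp add: orient_def)
    have "measure_pmf.expectation P (\<lambda>\<tau>. ?f (orient (\<lambda>v. s v * \<tau> v) c)) =
        measure_pmf.expectation (map_pmf (\<lambda>\<tau>. map \<tau> (vars c)) P) (\<lambda>b. ?f (orient s c \<odot> b))"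
      by (simp add: orient_mult[OF c])
    also have "map_pmf (\<lambda>\<tau>. map \<tau> (vars c)) P = replicate_pmf (length (vars c)) (Bern p)"
      unfolding P_def using cD by (intro map_Pi_pmf_distinct) auto
    finally show ?thesis by (simp add: hit_def len)
  qed
  have "lam k ?f (sym_pmf k ?N) p = measure_pmf.expectation ?N (\<lambda>c. hit S p (rep c))"
    unfolding lam_eq_hit[OF sym_pmf_in_Delta[OF N]] by (rule expectation_sym_pmf[OF N]) (rule hit)
  also have "\<dots> = (\<Sum>c\<leftarrow>\<Psi>. weight c * hit S p (rep (count_list (orient s c) 1))) / total_weight \<Psi>"
    by (rule expectation_count_pmf[OF \<Psi> W])
  also have "(\<Sum>c\<leftarrow>\<Psi>. weight c * hit S p (rep (count_list (orient s c) 1))) =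
      (\<Sum>c\<leftarrow>\<Psi>. measure_pmf.expectation P (\<lambda>\<tau>. weight c * ?f (orient (\<lambda>v. s v * \<tau> v) c)))"
    using E hit[OF orient_cube] by (intro arg_cong[of _ _ sum_list] map_cong) auto
  also have "\<dots> = measure_pmf.expectation P (\<lambda>\<tau>. \<Sum>c\<leftarrow>\<Psi>. weight c * ?f (orient (\<lambda>v. s v * \<tau> v) c))"
    by (rule expectation_sum_list[OF fin, symmetric])
  also have "\<dots> / total_weight \<Psi> = measure_pmf.expectation P (\<lambda>\<tau>. val_at ?f \<Psi> (map (\<lambda>v. s v * \<tau> v) [0..<n]))"
    by (simp add: val_at_eq_orient[OF \<Psi>])
  also have "\<dots> \<le> measure_pmf.expectation P (\<lambda>_. csp_val ?f n \<Psi>)"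
  proof (rule expectation_mono_pmf[OF fin])
    fix \<tau> assume "\<tau> \<in> set_pmf P"
    then have "s v * \<tau> v = -1 \<or> s v * \<tau> v = 1" for v using set_P[of \<tau> v] s[of v] by auto
    then have "map (\<lambda>v. s v * \<tau> v) [0..<n] \<in> cube n" by (auto simp: cube_iff_nth)
    then show "val_at ?f \<Psi> (map (\<lambda>v. s v * \<tau> v) [0..<n]) \<le> csp_val ?f n \<Psi>"
      unfolding csp_val_def by (intro Max_ge) auto
  qed
  finally show ?thesis by simp
qed

text \<open>The two-point laws with equality in Markov's inequality. With mean number of ones
  \<open>m\<close>, the support is \<open>{0, i}\<close> if \<open>m \<le> i\<close>, and
  \<open>{i, k}\<close> otherwise, where every draw is accepted.\<close>

lemma ex_pmf_gamma_star:
  assumes i: "1 \<le> i" "i \<le> k" and b: "0 \<le> b" "b \<le> 1"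
  shows "\<exists>N. set_pmf N \<subseteq> {..k} \<and> measure_pmf.expectation N (\<lambda>c. 2 * real c - real k) = real k * b \<and>
    measure_pmf.expectation N (\<lambda>c. of_bool (c \<in> {i..k})) = gamma_star k i b"
proof -
  define m where "m = real k * (1 + b) / 2"
  have mk: "m \<le> real k" "0 \<le> m"
    using b mult_left_mono[of b 1 "real k"] by (simp_all add: m_def field_simps)
  have gs: "gamma_star k i b = min 1 (m / real i)" by (simp add: gamma_star_def m_def)
  have kb: "real k * b = 2 * m - real k" by (simp add: m_def field_simps)
  show ?thesis
  proof (cases "m \<le> real i")
    case True
    define q where "q = m / real i"
    have q: "0 \<le> q" "q \<le> 1" "q * real i = m" using True mk i by (simp_all add: q_def)
    let ?N = "map_pmf (\<lambda>x. if x then i else 0) (bernoulli_pmf q)"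
    have "(2 * real i - real k) * q - real k * (1 - q) = real k * b"
      unfolding kb q(3)[symmetric] by (simp add: algebra_simps)
    moreover have "gamma_star k i b = q"
      unfolding gs q_def using q(2) by (simp add: q_def min_def)
    ultimately show ?thesis
      using q i by (intro exI[of _ ?N]) auto
  next
    case False
    \<comment> \<open>The mass on \<open>i\<close> that makes the mean of a law on
      \<open>{i, k}\<close> equal to \<open>m\<close>; the denominator is positive as
      \<open>i < m \<le> k\<close>.\<close>
    define q where "q = (real k - m) / (real k - real i)"
    have q: "0 \<le> q" "q \<le> 1" "q * (real k - real i) = real k - m"
      using False mk i by (simp_all add: q_def)
    let ?N = "map_pmf (\<lambda>x. if x then i else k) (bernoulli_pmf q)"
    have "(2 * real i - real k) * q + real k * (1 - q) = real k - 2 * (q * (real k - real i))"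
      by (simp add: algebra_simps)
    also have "\<dots> = real k * b"
      unfolding kb q(3) by simp
    finally have "(2 * real i - real k) * q + real k * (1 - q) = real k * b" .
    moreover have "gamma_star k i b = 1"
      unfolding gs using False i by (simp add: min_def field_simps)
    ultimately show ?thesis
      using q i by (intro exI[of _ ?N]) auto
  qed
qed

text \<open>Finiteness ensures that \<open>real_of_ereal\<close> preserves \<open>alpha\<close>. For
  the upper bound both distributions are the point mass at the all-ones vector.\<close>

lemma alpha_range:
  assumes i: "i \<le> k"
  shows "0 \<le> alpha k (sym_pred {i..k})" "alpha k (sym_pred {i..k}) \<le> 1"
proof -
  let ?f = "sym_pred {i..k}" and ?D = "sym_pmf k (return_pmf k)"
  show "0 \<le> alpha k ?f"
    unfolding alpha_def
  proof (rule Inf_greatest)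
    fix x assume "x \<in> {if gam k ?f DY = 0 then \<infinity> else ereal (beta k ?f DN / gam k ?f DY) | DN DY.
     DN \<in> Delta k \<and> DY \<in> Delta k \<and> mu DN = mu DY}"
    then obtain DN DY where "x = (if gam k ?f DY = 0 then \<infinity> else ereal (beta k ?f DN / gam k ?f DY))"
      and D: "DN \<in> Delta k" "DY \<in> Delta k" by blast
    with beta_bounds(2)[OF D(1)] lam_range[OF D(2), of "{i..k}" 1] show "0 \<le> x"
      by (auto simp: gam_def)
  qed
  have D: "?D \<in> Delta k" by (rule sym_pmf_in_Delta) simp
  have gam: "gam k ?f ?D = 1" using i by (subst gam_sym_pmf) auto
  have beta: "beta k ?f ?D \<le> 1"
    unfolding beta_def using lam_range[OF D] by (intro cSUP_least) auto
  have "alpha k ?f \<le> (if gam k ?f ?D = 0 then \<infinity> else ereal (beta k ?f ?D / gam k ?f ?D))"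
    unfolding alpha_def using D by (intro Inf_lower) blast
  also have "\<dots> \<le> 1" using gam beta by (simp add: one_ereal_def)
  finally show "alpha k ?f \<le> 1" .
qed

text \<open>\<open>DN\<close> comes from the instance after the majority flips and \<open>DY\<close>
  attains \<open>gamma_star\<close>. Both have mean \<open>bias k n \<Psi>\<close>, so the pair
  competes in the infimum defining \<open>alpha\<close>, while \<open>beta\<close> of
  \<open>DN\<close> is at most the value.\<close>

lemma alpha_gamma_star_le_csp_val:
  assumes \<Psi>: "\<Psi> \<in> csp_streams k n" and W: "total_weight \<Psi> > 0" and i: "1 \<le> i" "i \<le> k"
  shows "real_of_ereal (alpha k (sym_pred {i..k})) * gamma_star k i (bias k n \<Psi>)
    \<le> csp_val (sym_pred {i..k}) n \<Psi>"
proof -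
  let ?f = "sym_pred {i..k}" and ?b = "bias k n \<Psi>" and ?s = "majority k \<Psi>"
  have k: "k \<ge> 1" using i by simp
  note b = bias_range[OF \<Psi> W k]
  obtain NY where NY: "set_pmf NY \<subseteq> {..k}" "measure_pmf.expectation NY (\<lambda>c. 2 * real c - real k) = real k * ?b"
    "measure_pmf.expectation NY (\<lambda>c. of_bool (c \<in> {i..k})) = gamma_star k i ?b"
    using ex_pmf_gamma_star[OF i b] by blast
  define DN DY where "DN = sym_pmf k (count_pmf ?s \<Psi>)" and "DY = sym_pmf k NY"
  have NN: "set_pmf (count_pmf ?s \<Psi>) \<subseteq> {..k}"
    using \<Psi> W majority_cases by (rule set_count_pmf)
  have orient_cube: "orient ?s c \<in> cube k" if "c \<in> set \<Psi>" for c
    using \<Psi> that majority_cases by (rule orient_in_cube)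
  have DN: "DN \<in> Delta k" and DY: "DY \<in> Delta k"
    unfolding DN_def DY_def by (rule sym_pmf_in_Delta[OF NN], rule sym_pmf_in_Delta[OF NY(1)])
  have "real k * mu DN = measure_pmf.expectation (count_pmf ?s \<Psi>) (\<lambda>c. 2 * real c - real k)"
    unfolding DN_def by (rule mu_sym_pmf[OF NN])
  also have "\<dots> = (\<Sum>c\<leftarrow>\<Psi>. weight c * (2 * real (count_list (orient ?s c) 1) - real k)) / total_weight \<Psi>"
    by (rule expectation_count_pmf[OF \<Psi> W])
  also have "(\<Sum>c\<leftarrow>\<Psi>. weight c * (2 * real (count_list (orient ?s c) 1) - real k)) =
      (\<Sum>c\<leftarrow>\<Psi>. weight c * real_of_int (sum_list (orient ?s c)))"
    using sum_list_cube[OF orient_cube]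
    by (intro arg_cong[of _ _ sum_list] map_cong) auto
  also have "\<dots> / total_weight \<Psi> = real k * ?b"
    using k W by (simp add: bias_eq_majority[OF \<Psi>])
  finally have "real k * mu DN = real k * mu DY"
    unfolding DY_def mu_sym_pmf[OF NY(1)] NY(2) .
  then have mu: "mu DN = mu DY" using k by simp
  have gam: "gam k ?f DY = gamma_star k i ?b"
    unfolding DY_def gam_sym_pmf[OF NY(1)] NY(3) ..
  have pos: "gamma_star k i ?b > 0" using i b by (auto simp: gamma_star_def)
  have "alpha k ?f \<le> (if gam k ?f DY = 0 then \<infinity> else ereal (beta k ?f DN / gam k ?f DY))"
    unfolding alpha_def using DN DY mu by (intro Inf_lower) blast
  then have "alpha k ?f \<le> ereal (beta k ?f DN / gamma_star k i ?b)" using gam pos by simp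
  with alpha_range[OF i(2)] have "real_of_ereal (alpha k ?f) \<le> beta k ?f DN / gamma_star k i ?b"
    by (cases "alpha k ?f") auto
  then have "real_of_ereal (alpha k ?f) * gamma_star k i ?b \<le> beta k ?f DN"
    using pos by (simp add: field_simps)
  also have "beta k ?f DN \<le> csp_val ?f n \<Psi>"
    unfolding beta_def DN_def using lam_count_pmf_le_csp_val[OF \<Psi> W, of ?s, OF majority_cases]
    by (intro cSUP_least) auto
  finally show ?thesis .
qed

section \<open>The output function\<close>

lemma gamma_star_range:
  assumes "-1 \<le> b" shows "gamma_star k i b \<in> {0..1}"
  using assms by (simp add: gamma_star_def)

text \<open>The function \<open>\<lambda>b. 1 + b\<close> expands relative errors on \<open>b \<ge> 0\<close> by a factor at most \<open>1\<close>; this is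
  why no Lipschitz bound for \<open>alpha\<close> or \<open>beta\<close> is needed.\<close>

lemma gamma_star_relative_error:
  assumes b: "0 \<le> b" "b \<le> 1" and e: "0 < e" "e \<le> 1"
    and x: "(1 - e) * b \<le> x" "x \<le> (1 + e) * b"
  defines "y \<equiv> max (-1) (min 1 x)"
  shows "-1 \<le> y" "y \<le> 1" "(1 - e) * gamma_star k i b \<le> gamma_star k i y"
    "gamma_star k i y \<le> (1 + e) * gamma_star k i b"
proof -
  show "-1 \<le> y" "y \<le> 1" by (auto simp: y_def)
  have "0 \<le> (1 - e) * b" using b e by simp
  then have x0: "0 \<le> x" using x by linarith
  \<comment> \<open>Clipping from below never acts, as \<open>x\<close> is non-negative; clipping at
    1 keeps the lower bound because \<open>(1 - e) * b \<le> 1\<close>.\<close>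
  have y: "(1 - e) * b \<le> y" "y \<le> (1 + e) * b"
    using x x0 b e mult_right_le_one_le[of b "1 - e"] by (auto simp: y_def min_def mult.commute)
  have gs: "gamma_star k i z = min 1 (real k / (2 * real i) * (1 + z))" for z
    by (simp add: gamma_star_def)
  have "(1 - e) * (1 + b) \<le> 1 + y" "1 + y \<le> (1 + e) * (1 + b)"
    using y e by (simp_all add: algebra_simps)
  then have *: "(1 - e) * (real k / (2 * real i) * (1 + b)) \<le> real k / (2 * real i) * (1 + y)"
    "real k / (2 * real i) * (1 + y) \<le> (1 + e) * (real k / (2 * real i) * (1 + b))"
    unfolding mult.left_commute[of _ "real k / (2 * real i)"] by - (rule mult_left_mono, assumption, simp)+
  have "(1 - e) * gamma_star k i b \<le> 1 * 1"
    using e gamma_star_range[of b k i] b by (intro mult_mono) auto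
  moreover have "(1 - e) * gamma_star k i b \<le> (1 - e) * (real k / (2 * real i) * (1 + b))"
    unfolding gs using e by (intro mult_left_mono) auto
  ultimately show "(1 - e) * gamma_star k i b \<le> gamma_star k i y"
    using * unfolding gs[of y] by (intro min.boundedI) auto
  show "gamma_star k i y \<le> (1 + e) * gamma_star k i b"
    using * e unfolding gs by (auto simp: min_def)
qed

lemma piecewise_linear_gamma_star:
  assumes i: "1 \<le> i" "i \<le> k"
  shows "piecewise_linear_on (-1) 1 (\<lambda>x. a * gamma_star k i x)"
proof -
  \<comment> \<open>The kink of \<open>gamma_star\<close>, where
    \<open>k * (1 + m) / (2 * i) = 1\<close>.\<close>
  define m where "m = 2 * real i / real k - 1"
  have m: "-1 < m" "m \<le> 1" using i by (auto simp: m_def field_simps)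
  have lo: "a * gamma_star k i x = a * real k / (2 * real i) * x + a * real k / (2 * real i)" if "x \<le> m" for x
  proof -
    have "real k * (1 + x) / (2 * real i) \<le> 1"
      using that i by (simp add: m_def field_simps)
    then have "gamma_star k i x = real k * (1 + x) / (2 * real i)"
      unfolding gamma_star_def by (rule min_absorb2)
    then show ?thesis by (simp add: distrib_left add_divide_distrib)
  qed
  have hi: "a * gamma_star k i x = 0 * x + a" if "m \<le> x" for x
  proof -
    have "real k * (1 + x) / (2 * real i) \<ge> 1"
      using that i by (simp add: m_def field_simps)
    then have "gamma_star k i x = 1"
      unfolding gamma_star_def by (rule min_absorb1)
    then show ?thesis by simp
  qed
  show ?thesis
  \<comment> \<open>For \<open>i = k\<close> the kink is the right end point and must not be listed
    twice, since the partition is strictly increasing.\<close>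
  proof (cases "m = 1")
    case True
    show ?thesis
      unfolding piecewise_linear_on_def
    proof (intro exI[of _ "[-1, 1]"] conjI allI impI)
      fix j assume "Suc j < length [-1, 1 :: real]"
      then have "j = 0" by simp
      with True lo show "\<exists>c d. \<forall>x\<in>{[-1, 1] ! j..[-1, 1] ! Suc j}. a * gamma_star k i x = c * x + d"
        by (intro exI[of _ "a * real k / (2 * real i)"]) auto
    qed auto
  next
    case False
    show ?thesis
      unfolding piecewise_linear_on_def
    proof (intro exI[of _ "[-1, m, 1]"] conjI allI impI)
      fix j assume "Suc j < length [-1, m, 1]"
      then consider "j = 0" | "j = 1" by fastforce
      then show "\<exists>c d. \<forall>x\<in>{[-1, m, 1] ! j..[-1, m, 1] ! Suc j}. a * gamma_star k i x = c * x + d"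
      proof cases
        case 1
        with lo show ?thesis
          by (intro exI[of _ "a * real k / (2 * real i)"]) auto
      next
        case 2
        with hi show ?thesis by (intro exI[of _ 0] exI[of _ a]) auto
      qed
    qed (use m False in auto)
  qed
qed

text \<open>Dividing by \<open>1 + e\<close> cancels the largest overestimate of
  \<open>gamma_star\<close>, so a good estimate never leads above the value. The price is a factor
  \<open>(1 - e) / (1 + e)\<close> in the lower bound.\<close>

lemma bias_algorithm_approximates:
  fixes k i :: nat and \<epsilon> e :: real
  defines "a \<equiv> real_of_ereal (alpha k (sym_pred {i..k}))"
  assumes i: "1 \<le> i" "i \<le> k" and e: "0 < e" "e \<le> 1" "2 * e \<le> \<epsilon>"
    and X: "X \<subseteq> csp_streams k n" and A: "estimates_bias_on e k n X \<A>"
  shows "approximates_on (a - \<epsilon>) (sym_pred {i..k}) n X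
    (bias_algorithm (\<lambda>x. a / (1 + e) * gamma_star k i x) \<A>)"
  unfolding approximates_on_def
proof (intro ballI impI)
  fix \<Psi> assume "\<Psi> \<in> X" and W: "total_weight \<Psi> > 0"
  let ?f = "sym_pred {i..k}" and ?b = "bias k n \<Psi>" and ?g = "\<lambda>x. a / (1 + e) * gamma_star k i x"
  have \<Psi>: "\<Psi> \<in> csp_streams k n" using \<open>\<Psi> \<in> X\<close> X by blast
  have b: "0 \<le> ?b" "?b \<le> 1" using bias_range[OF \<Psi> W] i by auto
  have a: "0 \<le> a" "a \<le> 1"
    using alpha_range[OF i(2)] by (cases "alpha k ?f"; simp add: a_def)+
  have lower: "a * gamma_star k i ?b \<le> csp_val ?f n \<Psi>"
    unfolding a_def by (rule alpha_gamma_star_le_csp_val[OF \<Psi> W i])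
  have upper: "csp_val ?f n \<Psi> \<le> gamma_star k i ?b"
    by (rule csp_val_le_gamma_star[OF \<Psi> W i])
  have gs: "0 \<le> gamma_star k i ?b" using gamma_star_range[of ?b k i] b by simp
  have "0 \<le> csp_val ?f n \<Psi>"
    using lower a gs by (meson mult_nonneg_nonneg order_trans)
  have good: "(a - \<epsilon>) * csp_val ?f n \<Psi> \<le> ?g (max (-1) (min 1 x)) \<and> ?g (max (-1) (min 1 x)) \<le> csp_val ?f n \<Psi>"
    if x: "(1 - e) * ?b \<le> x" "x \<le> (1 + e) * ?b" for x
  proof
    let ?y = "max (-1) (min 1 x)"
    note y = gamma_star_relative_error[OF b e(1,2) x]
    have "?g ?y \<le> a / (1 + e) * ((1 + e) * gamma_star k i ?b)"
      using y(4) a e by (intro mult_left_mono) auto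
    also have "\<dots> = a * gamma_star k i ?b" using e by simp
    finally show "?g ?y \<le> csp_val ?f n \<Psi>" using lower by linarith
    \<comment> \<open>Expanded, this reads
      \<open>2 * a * e \<le> \<epsilon> + \<epsilon> * e\<close>, which follows from
      \<open>a \<le> 1\<close> and \<open>2 * e \<le> \<epsilon>\<close>.\<close>
    have "(a - \<epsilon>) * (1 + e) \<le> a * (1 - e)"
    proof -
      have "a * (2 * e) \<le> 1 * \<epsilon>" using a e by (intro mult_mono) auto
      moreover have "0 \<le> \<epsilon> * e" using e by simp
      ultimately show ?thesis by (simp add: algebra_simps)
    qed
    then have "a - \<epsilon> \<le> a / (1 + e) * (1 - e)" using e by (simp add: field_simps)
    then have "(a - \<epsilon>) * csp_val ?f n \<Psi> \<le> a / (1 + e) * (1 - e) * csp_val ?f n \<Psi>"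
      using \<open>0 \<le> csp_val ?f n \<Psi>\<close> by (rule mult_right_mono)
    also have "\<dots> \<le> a / (1 + e) * (1 - e) * gamma_star k i ?b"
      using upper a e by (intro mult_left_mono) auto
    also have "\<dots> \<le> a / (1 + e) * gamma_star k i ?y"
      unfolding mult.assoc using y(3) a e by (intro mult_left_mono) auto
    finally show "(a - \<epsilon>) * csp_val ?f n \<Psi> \<le> ?g ?y" .
  qed
  have "2 / 3 \<le> measure_pmf.prob \<A> {A. (1 - e) * ?b \<le> A \<Psi> \<and> A \<Psi> \<le> (1 + e) * ?b}"
    using A \<open>\<Psi> \<in> X\<close> W by (simp add: estimates_bias_on_def)
  also have "\<dots> \<le> measure_pmf.prob \<A> ((\<lambda>A \<Psi>. ?g (max (-1) (min 1 (A \<Psi>)))) -`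
      {A. (a - \<epsilon>) * csp_val ?f n \<Psi> \<le> A \<Psi> \<and> A \<Psi> \<le> csp_val ?f n \<Psi>})"
    using good by (intro measure_pmf.finite_measure_mono) auto
  finally show "2 / 3 \<le> measure_pmf.prob (bias_algorithm ?g \<A>)
      {A. (a - \<epsilon>) * csp_val ?f n \<Psi> \<le> A \<Psi> \<and> A \<Psi> \<le> csp_val ?f n \<Psi>}"
    by (simp add: bias_algorithm_def)
qed

text \<open>Post-processing only changes the output map; sketch and merge map are kept.\<close>

lemma sketching_bias_algorithm:
  assumes "sketching_algorithm s X \<A>"
  shows "sketching_algorithm s X (bias_algorithm g \<A>)"
  unfolding sketching_algorithm_def
proof
  fix B assume "B \<in> set_pmf (bias_algorithm g \<A>)"
  then obtain A where "A \<in> set_pmf \<A>" and B: "B = (\<lambda>\<Psi>. g (max (-1) (min 1 (A \<Psi>))))"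
    by (auto simp: bias_algorithm_def)
  with assms have "sketchable s X A" by (simp add: sketching_algorithm_def)
  then obtain sk :: "stream \<Rightarrow> bool list" and comb out where
    1: "\<forall>\<Psi>\<in>X. length (sk \<Psi>) = s \<and> A \<Psi> = out (sk \<Psi>)" and
    2: "\<forall>\<Psi>\<in>X. \<forall>\<Phi>\<in>X. \<Psi> @ \<Phi> \<in> X \<longrightarrow> sk (\<Psi> @ \<Phi>) = comb (sk \<Psi>) (sk \<Phi>)"
    unfolding sketchable_def by (elim exE conjE) (rule that)
  show "sketchable s X B"
    unfolding sketchable_def
    by (intro exI[of _ sk] exI[of _ comb] exI[of _ "\<lambda>u. g (max (-1) (min 1 (out u)))"])
      (use 1 2 B in simp)
qed

section \<open>The Fejer distribution\<close>

text \<open>\<open>fejer_pmf L\<close> lives on \<open>\<int>/2L\<close>; its weights are squared absolute values of the Fourier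
  coefficients of the indicator of \<open>{0..<L}\<close>, so that its characteristic function is the
  autocorrelation \<open>overlap L\<close> of that indicator, which equals \<open>1 - \<bar>m\<bar>/L\<close> for \<open>\<bar>m\<bar> \<le> L\<close>.\<close>

definition fejer_weight :: "nat \<Rightarrow> nat \<Rightarrow> real" where
  "fejer_weight L c = (norm (\<Sum>y<L. cis (pi * real c * real y / real L)))\<^sup>2 / (2 * (real L)\<^sup>2)"

definition overlap :: "nat \<Rightarrow> int \<Rightarrow> real" where
  "overlap L m = real (card {(y, y'). y < L \<and> y' < L \<and> 2 * int L dvd int y - int y' + m}) / real L"

definition fejer_pmf :: "nat \<Rightarrow> nat pmf" where
  "fejer_pmf L = pmf_of_list (map (\<lambda>c. (c, fejer_weight L c)) [0..<2 * L])"

text \<open>Orthogonality of the characters of the cyclic group of order \<open>2 * L\<close>: a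
  geometric sum over the powers of a root of unity \<open>z\<close>, with \<open>z = 1\<close>
  exactly in the divisible case.\<close>

lemma sum_cis_orthogonal:
  assumes L: "L > 0"
  shows "(\<Sum>c<2 * L. cis (pi * real c * of_int m / real L)) = (if 2 * int L dvd m then of_nat (2 * L) else 0)"
proof -
  define z where "z = cis (pi * of_int m / real L)"
  have power: "cis (pi * real c * of_int m / real L) = z ^ c" for c
  proof -
    have "pi * real c * of_int m / real L = real c * (pi * of_int m / real L)" by simp
    then show ?thesis by (simp only: z_def Complex.DeMoivre)
  qed
  have zN: "z ^ (2 * L) = 1"
  proof -
    have "real (2 * L) * (pi * of_int m / real L) = 2 * pi * of_int m" using L by simp
    then show ?thesis unfolding z_def Complex.DeMoivre by (simp add: cis_multiple_2pi)
  qed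
  have z1: "z = 1 \<longleftrightarrow> 2 * int L dvd m"
  proof
    assume "2 * int L dvd m"
    then obtain q where "m = 2 * int L * q" by (elim dvdE)
    then have "pi * of_int m / real L = 2 * pi * of_int q" using L by simp
    then show "z = 1" unfolding z_def by (simp add: cis_multiple_2pi)
  next
    assume "z = 1"
    then have "cos (pi * of_int m / real L) = 1" by (simp add: z_def complex_eq_iff)
    then obtain q :: int where "pi * of_int m / real L = of_int q * 2 * pi"
      using cos_one_2pi_int by blast
    then have "of_int m = (of_int (2 * int L * q) :: real)" using L by (simp add: field_simps)
    then have "m = 2 * int L * q" by (simp only: of_int_eq_iff)
    then show "2 * int L dvd m" by simp
  qed
  show ?thesis
  proof (cases "z = 1")
    case True
    then show ?thesis using z1 by (simp add: power)
  next
    case False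
    then have "(\<Sum>c<2 * L. z ^ c) = 0" using zN by (simp add: geometric_sum)
    then show ?thesis using z1 False by (simp add: power)
  qed
qed

text \<open>The Fourier transform of a squared modulus is the autocorrelation: expand the square
  into pairs \<open>(y, y')\<close>, exchange the sums and apply orthogonality.\<close>

lemma sum_fejer_weight_cis:
  assumes L: "L > 0"
  shows "(\<Sum>c<2 * L. of_real (fejer_weight L c) * cis (pi * real c * of_int m / real L)) = of_real (overlap L m)"
proof -
  define e where "e c t = cis (pi * real c * of_int t / real L)" for c :: nat and t :: int
  have e_mult: "e c s * e c t = e c (s + t)" for c s t
    by (simp add: e_def cis_mult add_divide_distrib distrib_left)
  have e_cnj: "cnj (e c t) = e c (- t)" for c t
    by (simp add: e_def cis_cnj)
  have w: "of_real (fejer_weight L c) * e c m =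
      (\<Sum>y<L. \<Sum>y'<L. e c (int y - int y' + m)) / of_nat (2 * L\<^sup>2)" for c
  proof -
    have "fejer_weight L c = (norm (\<Sum>y<L. e c (int y)))\<^sup>2 / real (2 * L\<^sup>2)"
      by (simp add: fejer_weight_def e_def)
    then have "complex_of_real (fejer_weight L c) =
        complex_of_real ((norm (\<Sum>y<L. e c (int y)))\<^sup>2) / of_nat (2 * L\<^sup>2)"
      by (simp only: of_real_divide of_real_of_nat_eq)
    moreover have "complex_of_real ((norm (\<Sum>y<L. e c (int y)))\<^sup>2) * e c m =
        (\<Sum>y<L. e c (int y)) * (\<Sum>y'<L. e c (- int y')) * e c m"
      by (simp only: complex_norm_square cnj_sum e_cnj)
    moreover have "\<dots> = (\<Sum>y<L. \<Sum>y'<L. e c (int y - int y' + m))"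
      by (subst sum_product) (simp only: sum_distrib_right e_mult add_uminus_conv_diff)
    ultimately show ?thesis by (simp only: times_divide_eq_left)
  qed
  have "(\<Sum>c<2 * L. of_real (fejer_weight L c) * e c m) =
      (\<Sum>c<2 * L. \<Sum>y<L. \<Sum>y'<L. e c (int y - int y' + m)) / of_nat (2 * L\<^sup>2)"
    by (simp only: w sum_divide_distrib)
  moreover have "(\<Sum>c<2 * L. \<Sum>y<L. \<Sum>y'<L. e c (int y - int y' + m)) =
      (\<Sum>y<L. \<Sum>y'<L. \<Sum>c<2 * L. e c (int y - int y' + m))"
    by (subst sum.swap) (intro sum.cong refl sum.swap)
  moreover have "\<dots> = (\<Sum>(y, y')\<in>{..<L} \<times> {..<L}. if 2 * int L dvd int y - int y' + m then of_nat (2 * L) else 0)"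
    by (simp only: e_def sum_cis_orthogonal[OF L] sum.cartesian_product)
  moreover have "\<dots> = (\<Sum>(y, y')\<in>{(y, y'). y < L \<and> y' < L \<and> 2 * int L dvd int y - int y' + m}. of_nat (2 * L))"
    by (intro sum.mono_neutral_cong_right) (auto split: if_splits simp del: of_nat_mult)
  moreover have "\<dots> / of_nat (2 * L\<^sup>2) = of_real (overlap L m)"
    using L by (simp add: overlap_def power2_eq_square)
  ultimately show ?thesis by (simp only: e_def)
qed

text \<open>Since \<open>y - y' + m\<close> is smaller than the modulus \<open>2 * L\<close> in
  absolute value, there is no wrap-around, and the pairs counted lie on one shifted diagonal of the
  square.\<close>

lemma overlap_eq:
  assumes L: "L > 0" and m: "\<bar>m\<bar> \<le> int L"
  shows "overlap L m = 1 - of_int \<bar>m\<bar> / real L"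
proof -
  let ?S = "{(y, y'). y < L \<and> y' < L \<and> 2 * int L dvd int y - int y' + m}"
  have dvd: "2 * int L dvd int y - int y' + m \<longleftrightarrow> int y - int y' + m = 0" if "y < L" "y' < L" for y y'
  proof
    assume "2 * int L dvd int y - int y' + m"
    moreover have "\<bar>int y - int y' + m\<bar> < 2 * int L" using that m by linarith
    ultimately show "int y - int y' + m = 0" by (metis dvd_abs_iff abs_ge_zero abs_eq_0 zdvd_not_zless order_le_less)
  qed simp
  define a where "a = nat \<bar>m\<bar>"
  \<comment> \<open>A pair on this diagonal is determined by its smaller entry.\<close>
  have "bij_betw (\<lambda>u. if 0 \<le> m then (u, u + a) else (u + a, u)) {..<L - a} ?S"
    by (rule bij_betwI[where g = "\<lambda>(y, y'). min y y'"])
      (use m in \<open>auto simp: dvd a_def min_def split: if_splits\<close>)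
  then have "card ?S = L - a" by (auto dest: bij_betw_same_card)
  then show ?thesis using m L by (simp add: overlap_def a_def of_nat_diff field_simps)
qed

text \<open>The total mass is the characteristic function at 0, and
  \<open>overlap L 0 = 1\<close>.\<close>

lemma fejer_pmf_wf:
  assumes L: "L > 0"
  shows "pmf_of_list_wf (map (\<lambda>c. (c, fejer_weight L c)) [0..<2 * L])"
proof (rule pmf_of_list_wfI)
  have "complex_of_real (\<Sum>c<2 * L. fejer_weight L c) = 1"
    using sum_fejer_weight_cis[OF L, of 0] overlap_eq[OF L, of 0] by simp
  then have "(\<Sum>c<2 * L. fejer_weight L c) = 1" by (simp only: of_real_eq_1_iff)
  then show "sum_list (map snd (map (\<lambda>c. (c, fejer_weight L c)) [0..<2 * L])) = 1"
    by (simp add: o_def interv_sum_list_conv_sum_set_nat atLeast0LessThan)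
qed (auto simp: fejer_weight_def)

lemma finite_set_fejer_pmf [simp]: "L > 0 \<Longrightarrow> finite (set_pmf (fejer_pmf L))"
  unfolding fejer_pmf_def by (rule finite_set_pmf_of_list[OF fejer_pmf_wf])

text \<open>The characteristic function is real, so the sine part of the addition theorem averages
  to 0. The phase \<open>a\<close> is carried for the induction in
  \<open>expectation_cos_projection\<close>.\<close>

lemma expectation_fejer_pmf:
  assumes L: "L > 0"
  shows "measure_pmf.expectation (fejer_pmf L) (\<lambda>c. cos (a + pi * real c * of_int m / real L)) = cos a * overlap L m"
proof -
  note cis = arg_cong[OF sum_fejer_weight_cis[OF L, of m]]
  have "(\<Sum>c<2 * L. fejer_weight L c * cos (pi * real c * of_int m / real L)) = overlap L m"
    "(\<Sum>c<2 * L. fejer_weight L c * sin (pi * real c * of_int m / real L)) = 0"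
    using cis[of Re] cis[of Im] by simp_all
  moreover have "measure_pmf.expectation (fejer_pmf L) (\<lambda>c. cos (a + pi * real c * of_int m / real L)) =
      (\<Sum>c<2 * L. fejer_weight L c * cos (a + pi * real c * of_int m / real L))"
    unfolding fejer_pmf_def expectation_pmf_of_list[OF fejer_pmf_wf[OF L]]
    by (simp add: o_def interv_sum_list_conv_sum_set_nat atLeast0LessThan)
  moreover have "\<dots> = cos a * (\<Sum>c<2 * L. fejer_weight L c * cos (pi * real c * of_int m / real L)) -
      sin a * (\<Sum>c<2 * L. fejer_weight L c * sin (pi * real c * of_int m / real L))"
    by (simp add: cos_add right_diff_distrib sum_subtractf sum_distrib_left mult.left_commute)
  ultimately show ?thesis by simp
qed

lemma finite_set_Pi_pmf:
  assumes "finite A" "\<And>x. x \<in> A \<Longrightarrow> finite (set_pmf (p x))"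
  shows "finite (set_pmf (Pi_pmf A d p))"
  using assms by (intro finite_subset[OF set_Pi_pmf_subset'] finite_PiE_dflt) auto

lemma expectation_Pi_insert:
  fixes f :: "('a \<Rightarrow> 'b) \<Rightarrow> real"
  assumes "finite A" "x \<notin> A" "\<And>y. y \<in> insert x A \<Longrightarrow> finite (set_pmf (p y))"
  shows "measure_pmf.expectation (Pi_pmf (insert x A) d p) f =
    measure_pmf.expectation (p x) (\<lambda>y. measure_pmf.expectation (Pi_pmf A d p) (\<lambda>g. f (g(x := y))))"
proof -
  have fin: "finite (set_pmf (Pi_pmf A d p))" "finite (set_pmf (p x))"
    using assms by (auto intro: finite_set_Pi_pmf)
  then show ?thesis
    unfolding Pi_pmf_insert[OF assms(1,2)] integral_map_pmf
    by (subst expectation_pair_finite) auto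
qed

text \<open>Characteristic functions of independent summands multiply. In the induction step the
  contribution of the new coefficient is absorbed into the phase.\<close>

lemma expectation_cos_projection:
  assumes L: "L > 0" and "finite V"
  shows "measure_pmf.expectation (Pi_pmf V 0 (\<lambda>_. fejer_pmf L))
    (\<lambda>T. cos (a + pi * of_int (\<Sum>v\<in>V. int (T v) * x v) / real L)) = cos a * (\<Prod>v\<in>V. overlap L (x v))"
  using \<open>finite V\<close>
proof (induction V arbitrary: a)
  case (insert v V)
  have "measure_pmf.expectation (Pi_pmf (insert v V) 0 (\<lambda>_. fejer_pmf L))
      (\<lambda>T. cos (a + pi * of_int (\<Sum>v\<in>insert v V. int (T v) * x v) / real L)) =
    measure_pmf.expectation (fejer_pmf L) (\<lambda>c. measure_pmf.expectation (Pi_pmf V 0 (\<lambda>_. fejer_pmf L))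
      (\<lambda>T. cos ((a + pi * real c * of_int (x v) / real L) + pi * of_int (\<Sum>v\<in>V. int (T v) * x v) / real L)))"
  proof (subst expectation_Pi_insert[OF insert.hyps], simp add: L, rule expectation_cong_pmf, rule expectation_cong_pmf)
    fix c T
    have "(\<Sum>u\<in>V. int ((T(v := c)) u) * x u) = (\<Sum>u\<in>V. int (T u) * x u)"
      using insert.hyps by (intro sum.cong) auto
    then show "cos (a + pi * of_int (\<Sum>u\<in>insert v V. int ((T(v := c)) u) * x u) / real L) =
        cos ((a + pi * real c * of_int (x v) / real L) + pi * of_int (\<Sum>u\<in>V. int (T u) * x u) / real L)"
      using insert.hyps by (simp add: distrib_left add_divide_distrib mult.assoc add.assoc)
  qed
  also have "\<dots> = measure_pmf.expectation (fejer_pmf L)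
      (\<lambda>c. cos (a + pi * real c * of_int (x v) / real L) * (\<Prod>v\<in>V. overlap L (x v)))"
    by (simp only: insert.IH)
  also have "\<dots> = cos a * (\<Prod>v\<in>insert v V. overlap L (x v))"
    using insert.hyps by (simp add: expectation_fejer_pmf[OF L])
  finally show ?case .
qed simp

section \<open>Concentration of the average of independent copies\<close>

text \<open>The cross terms vanish by independence and centering.\<close>

lemma second_moment_sum_Pi_pmf:
  fixes g :: "'a \<Rightarrow> real"
  assumes "finite A" "finite (set_pmf Q)" "measure_pmf.expectation Q g = 0"
  shows "measure_pmf.expectation (Pi_pmf A d (\<lambda>_. Q)) (\<lambda>\<omega>. (\<Sum>r\<in>A. g (\<omega> r))\<^sup>2) =
    real (card A) * measure_pmf.expectation Q (\<lambda>y. (g y)\<^sup>2)"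
  using assms(1)
proof (induction A)
  case (insert r A)
  let ?P = "Pi_pmf A d (\<lambda>_. Q)"
  have fin: "finite (set_pmf ?P)" using insert assms by (intro finite_set_Pi_pmf) auto
  have int: "integrable ?P f1" "integrable Q f2" for f1 :: "('b \<Rightarrow> 'a) \<Rightarrow> real" and f2 :: "'a \<Rightarrow> real"
    using fin assms(2) by (auto intro: integrable_measure_pmf_finite)
  have mean: "measure_pmf.expectation ?P (\<lambda>\<omega>. \<Sum>r\<in>A. g (\<omega> r)) = 0"
  proof -
    have "measure_pmf.expectation ?P (\<lambda>\<omega>. g (\<omega> r)) = 0" if "r \<in> A" for r
    proof -
      have "measure_pmf.expectation ?P (\<lambda>\<omega>. g (\<omega> r)) = measure_pmf.expectation (map_pmf (\<lambda>\<omega>. \<omega> r) ?P) g"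
        by simp
      then show ?thesis using that insert.hyps(1) assms(3) by (simp only: Pi_pmf_component if_True)
    qed
    then show ?thesis
      using int by (subst Bochner_Integration.integral_sum) auto
  qed
  have "measure_pmf.expectation (Pi_pmf (insert r A) d (\<lambda>_. Q)) (\<lambda>\<omega>. (\<Sum>r\<in>insert r A. g (\<omega> r))\<^sup>2) =
    measure_pmf.expectation Q (\<lambda>y. measure_pmf.expectation ?P (\<lambda>\<omega>. (g y)\<^sup>2 + 2 * g y * (\<Sum>r\<in>A. g (\<omega> r)) + (\<Sum>r\<in>A. g (\<omega> r))\<^sup>2))"
  proof (subst expectation_Pi_insert[OF insert.hyps], simp add: assms, rule expectation_cong_pmf, rule expectation_cong_pmf)
    fix y h
    have "(\<Sum>u\<in>A. g ((h(r := y)) u)) = (\<Sum>u\<in>A. g (h u))"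
      using insert.hyps by (intro sum.cong) auto
    then show "(\<Sum>u\<in>insert r A. g ((h(r := y)) u))\<^sup>2 =
        (g y)\<^sup>2 + 2 * g y * (\<Sum>r\<in>A. g (h r)) + (\<Sum>r\<in>A. g (h r))\<^sup>2"
      using insert.hyps by (simp add: power2_sum)
  qed
  also have "\<dots> = measure_pmf.expectation Q (\<lambda>y. (g y)\<^sup>2 + measure_pmf.expectation ?P (\<lambda>\<omega>. (\<Sum>r\<in>A. g (\<omega> r))\<^sup>2))"
    by (simp add: mean int)
  also have "\<dots> = real (card (insert r A)) * measure_pmf.expectation Q (\<lambda>y. (g y)\<^sup>2)"
    using insert.hyps by (simp add: int insert.IH distrib_right)
  finally show ?case .
qed simp

text \<open>Chebyshev's inequality; the 4 bounds the variance, since \<open>f\<close> and its mean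
  lie in \<open>[-1,1]\<close>.\<close>

lemma prob_average_deviation:
  fixes f :: "'a \<Rightarrow> real"
  assumes fin: "finite (set_pmf Q)" and f: "\<And>y. \<bar>f y\<bar> \<le> 1"
    and \<delta>: "\<delta> > 0" and R: "R > 0"
  shows "measure_pmf.prob (Pi_pmf {..<R} d (\<lambda>_. Q))
    {\<omega>. \<bar>(\<Sum>r<R. f (\<omega> r)) / real R - measure_pmf.expectation Q f\<bar> > \<delta>} \<le> 4 / (real R * \<delta>\<^sup>2)"
proof -
  define \<mu> where "\<mu> = measure_pmf.expectation Q f"
  define g where "g y = f y - \<mu>" for y
  let ?P = "Pi_pmf {..<R} d (\<lambda>_. Q)"
  let ?B = "{\<omega>. \<bar>(\<Sum>r<R. f (\<omega> r)) / real R - \<mu>\<bar> > \<delta>}"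
  have finP: "finite (set_pmf ?P)" using fin by (intro finite_set_Pi_pmf) auto
  have "\<bar>\<mu>\<bar> \<le> 1"
  proof -
    have "\<mu> \<le> measure_pmf.expectation Q (\<lambda>_. 1)" "measure_pmf.expectation Q (\<lambda>_. -1) \<le> \<mu>"
      unfolding \<mu>_def
      by (rule expectation_mono_pmf[OF fin], use f in \<open>simp add: abs_le_iff minus_le_iff\<close>)+
    then show ?thesis by simp
  qed
  have "(g y)\<^sup>2 \<le> 4" for y
  proof -
    have "\<bar>g y\<bar> \<le> 2" using f[of y] \<open>\<bar>\<mu>\<bar> \<le> 1\<close> by (simp add: g_def)
    then have "\<bar>g y\<bar>\<^sup>2 \<le> 2\<^sup>2" by (intro power_mono) auto
    then show ?thesis by simp
  qed
  then have g2: "measure_pmf.expectation Q (\<lambda>y. (g y)\<^sup>2) \<le> 4"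
    using expectation_mono_pmf[OF fin, of "\<lambda>y. (g y)\<^sup>2" "\<lambda>_. 4"] by simp
  have g0: "measure_pmf.expectation Q g = 0"
    unfolding g_def using integrable_measure_pmf_finite[OF fin, of f] by (simp add: \<mu>_def)
  have sum_g: "(\<Sum>r<R. g (\<omega> r)) = real R * ((\<Sum>r<R. f (\<omega> r)) / real R - \<mu>)" for \<omega>
    using R by (simp add: g_def sum_subtractf right_diff_distrib)
  have "measure_pmf.prob ?P ?B = measure_pmf.expectation ?P (indicator ?B)" by simp
  also have "\<dots> \<le> measure_pmf.expectation ?P (\<lambda>\<omega>. (\<Sum>r<R. g (\<omega> r))\<^sup>2 / (real R * \<delta>)\<^sup>2)"
  proof (rule expectation_mono_pmf[OF finP])
    fix \<omega>
    show "indicator ?B \<omega> \<le> (\<Sum>r<R. g (\<omega> r))\<^sup>2 / (real R * \<delta>)\<^sup>2"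
    proof (cases "\<omega> \<in> ?B")
      case True
      then have "real R * \<delta> \<le> \<bar>\<Sum>r<R. g (\<omega> r)\<bar>" using R unfolding sum_g by (simp add: abs_mult)
      then have "(real R * \<delta>)\<^sup>2 \<le> (\<Sum>r<R. g (\<omega> r))\<^sup>2"
        using \<delta> R power_mono[of "real R * \<delta>" "\<bar>\<Sum>r<R. g (\<omega> r)\<bar>" 2] by simp
      then show ?thesis using True \<delta> R by simp
    qed simp
  qed
  also have "\<dots> = real R * measure_pmf.expectation Q (\<lambda>y. (g y)\<^sup>2) / (real R * \<delta>)\<^sup>2"
    using second_moment_sum_Pi_pmf[OF _ fin g0, of "{..<R}" d] by simp
  also have "\<dots> \<le> real R * 4 / (real R * \<delta>)\<^sup>2"
    using g2 by (intro divide_right_mono mult_left_mono) auto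
  also have "\<dots> = 4 / (real R * \<delta>\<^sup>2)" using R \<delta> by (simp add: power2_eq_square)
  finally show ?thesis unfolding \<mu>_def .
qed

section \<open>Recovering the norm from the expected observations\<close>

definition l1 :: "nat \<Rightarrow> (nat \<Rightarrow> int) \<Rightarrow> int" where
  "l1 n x = (\<Sum>v<n. \<bar>x v\<bar>)"

text \<open>Second-order counterpart of \<open>Weierstrass_prod_ineq\<close>: together they enclose
  the product with a quadratic error. In the induction step the excess over the claimed bound is
  minus a sum of non-negative terms.\<close>

lemma prod_one_minus_le:
  fixes a :: "'a \<Rightarrow> real"
  assumes "finite V" "\<And>v. v \<in> V \<Longrightarrow> 0 \<le> a v \<and> a v \<le> 1"
  shows "(\<Prod>v\<in>V. 1 - a v) \<le> 1 - sum a V + (sum a V)\<^sup>2 / 2"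
  using assms
proof (induction V)
  case (insert v V)
  let ?s = "sum a V"
  have a: "0 \<le> a v" "a v \<le> 1" "0 \<le> ?s" using insert.prems by (auto intro: sum_nonneg)
  have "(\<Prod>v\<in>insert v V. 1 - a v) \<le> (1 - a v) * (1 - ?s + ?s\<^sup>2 / 2)"
    using insert a by (simp add: mult_left_mono)
  also have "\<dots> = 1 - (a v + ?s) + (a v + ?s)\<^sup>2 / 2 - ((a v)\<^sup>2 + a v * ?s\<^sup>2) / 2"
    by (simp add: power2_eq_square field_simps)
  also have "\<dots> \<le> 1 - (a v + ?s) + (a v + ?s)\<^sup>2 / 2" using a by simp
  finally show ?case using insert.hyps by simp
qed simp

text \<open>At a scale not below the norm no coordinate exceeds \<open>L\<close>, so every factor is
  in the linear range of \<open>overlap_eq\<close>.\<close>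

lemma prod_overlap_bounds:
  assumes L: "L > 0" and x: "l1 n x \<le> int L"
  defines "s \<equiv> of_int (l1 n x) / real L"
  shows "1 - s \<le> (\<Prod>v<n. overlap L (x v))" "(\<Prod>v<n. overlap L (x v)) \<le> 1 - s + s\<^sup>2 / 2"
proof -
  define a where "a v = of_int \<bar>x v\<bar> / real L" for v
  have le: "\<bar>x v\<bar> \<le> int L" if "v < n" for v
    using x member_le_sum[of v "{..<n}" "\<lambda>v. \<bar>x v\<bar>"] that by (simp add: l1_def)
  have a: "0 \<le> a v \<and> a v \<le> 1" if "v \<in> {..<n}" for v
  proof -
    have "real_of_int \<bar>x v\<bar> \<le> real_of_int (int L)" using le that by (simp only: of_int_le_iff lessThan_iff)
    then show ?thesis using L by (simp add: a_def)
  qed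
  have ov: "(\<Prod>v<n. overlap L (x v)) = (\<Prod>v<n. 1 - a v)"
    by (intro prod.cong) (simp_all add: overlap_eq[OF L le] a_def)
  have s: "s = sum a {..<n}" by (simp add: s_def l1_def a_def sum_divide_distrib)
  show "1 - s \<le> (\<Prod>v<n. overlap L (x v))"
    unfolding ov s using a by (intro Weierstrass_prod_ineq) auto
  show "(\<Prod>v<n. overlap L (x v)) \<le> 1 - s + s\<^sup>2 / 2"
    unfolding ov s using a by (intro prod_one_minus_le) auto
qed

lemma l1_nonneg: "0 \<le> l1 n x"
  by (simp add: l1_def sum_nonneg)

text \<open>At a scale about \<open>2 ^ a\<close> times the larger norm, the product is linear in
  the norm up to a relative error of order \<open>1 / 2 ^ a\<close>, while the error
  \<open>2 * \<delta>\<close> is magnified by the scale. The assumptions keep each of the two errors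
  below or equal to \<open>e / 2\<close> times the larger norm.\<close>

lemma l1_le_if_observations_close:
  assumes close: "\<And>j. j < a + b + 1 \<Longrightarrow>
      \<bar>(\<Prod>v<n. overlap (2 ^ j) (x v)) - (\<Prod>v<n. overlap (2 ^ j) (y v))\<bar> \<le> 2 * \<delta>"
    and b: "l1 n y < 2 ^ b" and \<delta>: "8 * \<delta> * 2 ^ a \<le> e" and a: "1 / 2 ^ a \<le> e"
    and le: "l1 n x \<le> l1 n y"
  shows "(1 - e) * of_int (l1 n y) \<le> of_int (l1 n x)"
proof (cases "l1 n y = 0")
  case True
  then show ?thesis using l1_nonneg[of n x] by simp
next
  case False
  define A where "A = nat (l1 n y)"
  have A: "int A = l1 n y" "A \<ge> 1" using False l1_nonneg[of n y] by (auto simp: A_def)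
  have Ar: "real_of_int (l1 n y) = real A" by (simp add: A(1)[symmetric])
  obtain q where q: "2 ^ q \<le> A" "A < 2 ^ (q + 1)"
    using ex_power_ivl1[of 2 A] A by auto
  have "2 ^ q < (2::int) ^ b" using q(1) b A by (metis of_nat_le_iff of_nat_numeral of_nat_power order_le_less_trans)
  then have qb: "q < b" by simp
  \<comment> \<open>The bounds on \<open>q\<close> put \<open>L = 2 ^ j\<close> between
    \<open>2 ^ a * A\<close> and \<open>2 * 2 ^ a * A\<close>, and \<open>q < b\<close> makes
    \<open>j\<close> one of the observed scales.\<close>
  define j where "j = a + q + 1"
  define L :: nat where "L = 2 ^ j"
  have j: "j < a + b + 1" using qb by (simp add: j_def)
  have L: "L > 0" by (simp add: L_def)
  have LA: "2 ^ a * A \<le> L" "L \<le> 2 * 2 ^ a * A"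
    using q by (simp_all add: L_def j_def power_add)
  have "A \<le> L" using LA(1) by (metis le_trans mult_le_mono1 nat_mult_1 one_le_numeral one_le_power)
  then have Ly: "l1 n y \<le> int L" using A by simp
  define s t where "s = of_int (l1 n x) / real L" and "t = of_int (l1 n y) / real L"
  \<comment> \<open>Lower bound at \<open>x\<close>, upper bound at \<open>y\<close>: only the
    latter brings in a quadratic error, which becomes \<open>t * real A / 2\<close> after scaling by
    \<open>L\<close>.\<close>
  have "1 - s - (1 - t + t\<^sup>2 / 2) \<le> 2 * \<delta>"
    using close[OF j] prod_overlap_bounds(1)[OF L, of n x] prod_overlap_bounds(2)[OF L Ly] le Ly
    unfolding s_def t_def L_def[symmetric] by linarith
  then have "t - s \<le> 2 * \<delta> + t\<^sup>2 / 2" by simp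
  then have "(t - s) * real L \<le> (2 * \<delta> + t\<^sup>2 / 2) * real L" by (intro mult_right_mono) auto
  moreover have "(t - s) * real L = real A - of_int (l1 n x)"
    using L by (simp add: s_def t_def left_diff_distrib Ar)
  moreover have "t\<^sup>2 * real L = t * real A"
    using L by (simp add: t_def power2_eq_square Ar)
  ultimately have main: "real A - of_int (l1 n x) \<le> 2 * \<delta> * real L + t * real A / 2"
    by (simp add: distrib_right)
  have LAr: "2 ^ a * real A \<le> real L" "real L \<le> 2 * 2 ^ a * real A"
    using LA by (simp_all only: of_nat_le_iff of_nat_mult of_nat_power of_nat_numeral flip: of_nat_le_iff[where 'a = real])
  have "t \<le> 1 / 2 ^ a"
    using LAr(1) L by (simp add: t_def Ar field_simps)
  with a have t: "t * real A \<le> e * real A" by (intro mult_right_mono) auto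
  have "0 \<le> 2 * \<delta>" using close[OF j] by linarith
  then have "2 * \<delta> * real L \<le> 2 * \<delta> * (2 * 2 ^ a * real A)"
    using LAr(2) by (intro mult_left_mono) auto
  also have "\<dots> = (8 * \<delta> * 2 ^ a) * real A / 2" by simp
  also have "\<dots> \<le> e * real A / 2" using \<delta> by (intro divide_right_mono mult_right_mono) auto
  finally have "real A - of_int (l1 n x) \<le> e * real A" using main t by simp
  then show ?thesis by (simp add: Ar left_diff_distrib)
qed

section \<open>Mergeable sketches of the bias\<close>

text \<open>Abstract states embed into the \<open>2 ^ s\<close> bit strings; merging decodes, merges
  and encodes again. So sketches can be described by numbers and functions.\<close>

lemma sketchable_if_finite_state:
  fixes st :: "stream \<Rightarrow> 'a"
  assumes T: "finite T" "card T \<le> 2 ^ s"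
    and st: "\<And>\<Psi>. \<Psi> \<in> X \<Longrightarrow> st \<Psi> \<in> T" "\<And>\<Psi>. \<Psi> \<in> X \<Longrightarrow> A \<Psi> = out (st \<Psi>)"
    and merge: "\<And>\<Psi> \<Phi>. \<Psi> \<in> X \<Longrightarrow> \<Phi> \<in> X \<Longrightarrow> \<Psi> @ \<Phi> \<in> X \<Longrightarrow> st (\<Psi> @ \<Phi>) = comb (st \<Psi>) (st \<Phi>)"
  shows "sketchable s X A"
proof -
  let ?C = "{xs :: bool list. length xs = s}"
  have "card ?C = 2 ^ s" "finite ?C"
    using card_lists_length_eq[of "UNIV :: bool set" s] finite_lists_length_eq[of "UNIV :: bool set" s] by simp_all
  then obtain enc where enc: "enc ` T \<subseteq> ?C" "inj_on enc T"
    using T card_le_inj[of T ?C] by auto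
  define dec where "dec = inv_into T enc"
  have dec: "dec (enc t) = t" "length (enc t) = s" if "t \<in> T" for t
    using that enc by (auto simp: dec_def)
  show ?thesis
    unfolding sketchable_def
    by (intro exI[of _ "\<lambda>\<Psi>. enc (st \<Psi>)"] exI[of _ "\<lambda>a b. enc (comb (dec a) (dec b))"] exI[of _ "\<lambda>a. out (dec a)"])
      (use st merge dec in auto)
qed

text \<open>The floor only changes the type: on integer streams \<open>diff\<close> is an
  integer.\<close>

definition int_diff :: "nat \<Rightarrow> stream \<Rightarrow> nat \<Rightarrow> int" where
  "int_diff k \<Psi> v = \<lfloor>diff k v \<Psi>\<rfloor>"

lemma diff_append: "diff k v (\<Psi> @ \<Phi>) = diff k v \<Psi> + diff k v \<Phi>"
  by (simp add: diff_def)

lemma integer_streamsD: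
  assumes "\<Psi> \<in> integer_streams k n M"
  shows "\<Psi> \<in> csp_streams k n" "c \<in> set \<Psi> \<Longrightarrow> weight c \<in> \<nat>" "total_weight \<Psi> \<le> real M"
  using assms by (auto simp: integer_streams_def)

lemma diff_Ints:
  assumes "\<Psi> \<in> integer_streams k n M"
  shows "diff k v \<Psi> \<in> \<int>"
proof -
  have "diff k v \<Psi> \<in> \<int>" if "\<And>c. c \<in> set \<Psi> \<Longrightarrow> weight c \<in> \<nat>" for \<Psi>
    using that
  proof (induction \<Psi>)
    case (Cons c \<Psi>)
    have "weight c \<in> \<int>" using Cons.prems[of c] by (auto simp: Nats_def)
    then have "(\<Sum>t | t < k \<and> vars c ! t = v. of_int (signs c ! t) * weight c) \<in> \<int>"
      by (intro Ints_sum Ints_mult) auto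
    with Cons show ?case by (simp add: diff_def)
  qed (simp add: diff_def)
  then show ?thesis using integer_streamsD(2)[OF assms] by blast
qed

lemma of_int_int_diff: "\<Psi> \<in> integer_streams k n M \<Longrightarrow> of_int (int_diff k \<Psi> v) = diff k v \<Psi>"
  unfolding int_diff_def using diff_Ints by simp

lemma int_diff_append:
  assumes "\<Psi> \<in> integer_streams k n M" "\<Phi> \<in> integer_streams k n M"
  shows "int_diff k (\<Psi> @ \<Phi>) v = int_diff k \<Psi> v + int_diff k \<Phi> v"
proof -
  have "diff k v (\<Psi> @ \<Phi>) = of_int (int_diff k \<Psi> v + int_diff k \<Phi> v)"
    using assms by (simp add: diff_append of_int_int_diff)
  then show ?thesis unfolding int_diff_def[of k "\<Psi> @ \<Phi>"] by (simp only: floor_of_int)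
qed

lemma total_weight_integer_stream:
  assumes "\<Psi> \<in> integer_streams k n M"
  shows "total_weight \<Psi> \<in> real ` {..M}"
proof -
  have "total_weight \<Psi> \<in> \<nat>" if "\<And>c. c \<in> set \<Psi> \<Longrightarrow> weight c \<in> \<nat>" for \<Psi>
    using that by (induction \<Psi>) (auto simp: total_weight_def)
  then have "total_weight \<Psi> \<in> \<nat>" using integer_streamsD(2)[OF assms] .
  then show ?thesis using integer_streamsD(3)[OF assms] by (auto simp: Nats_def)
qed

text \<open>\<open>\<omega> j r v\<close> is the random coefficient of variable \<open>v\<close> in repetition \<open>r\<close> at scale \<open>2 ^ j\<close>.\<close>

type_synonym coefficients = "nat \<Rightarrow> nat \<Rightarrow> nat \<Rightarrow> nat"

definition coeff_pmf :: "nat \<Rightarrow> nat \<Rightarrow> nat \<Rightarrow> coefficients pmf" where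
  "coeff_pmf n R J = Pi_pmf {..<J} (\<lambda>_ _. 0)
    (\<lambda>j. Pi_pmf {..<R} (\<lambda>_. 0) (\<lambda>_. Pi_pmf {..<n} 0 (\<lambda>_. fejer_pmf (2 ^ j))))"

text \<open>Residues suffice because the cosine in \<open>observation\<close> has period
  \<open>2 * 2 ^ j\<close> in them, and they keep the state space finite. \<open>restrict\<close>
  places the state in a countable product \<open>PiE\<close> of finite ranges.\<close>

definition projections :: "nat \<Rightarrow> nat \<Rightarrow> nat \<Rightarrow> coefficients \<Rightarrow> (nat \<Rightarrow> int) \<Rightarrow> nat \<Rightarrow> nat \<Rightarrow> int" where
  "projections n R J \<omega> x =
    (\<lambda>j\<in>{..<J}. \<lambda>r\<in>{..<R}. (\<Sum>v<n. int (\<omega> j r v) * x v) mod (2 * 2 ^ j))"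

definition observation :: "nat \<Rightarrow> (nat \<Rightarrow> nat \<Rightarrow> int) \<Rightarrow> nat \<Rightarrow> real" where
  "observation R u j = (\<Sum>r<R. cos (pi * of_int (u j r) / 2 ^ j)) / real R"

text \<open>With \<open>J = a + b + 1\<close> the norm bound ensures that one of the scales fits the
  norm of every non-zero candidate, not just that of the true vector.\<close>

definition consistent :: "nat \<Rightarrow> nat \<Rightarrow> nat \<Rightarrow> real \<Rightarrow> nat \<Rightarrow> (nat \<Rightarrow> nat \<Rightarrow> int) \<Rightarrow> (nat \<Rightarrow> int) \<Rightarrow> bool" where
  "consistent n R J \<delta> b u x \<longleftrightarrow> l1 n x < 2 ^ b \<and>
    (\<forall>j<J. \<bar>observation R u j - (\<Prod>v<n. overlap (2 ^ j) (x v))\<bar> \<le> \<delta>)"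

text \<open>Which consistent vector is chosen is immaterial: by \<open>l1_relative_error\<close>,
  for suitable parameters, all of them have nearly the same norm.\<close>

definition decode :: "nat \<Rightarrow> nat \<Rightarrow> nat \<Rightarrow> nat \<Rightarrow> real \<Rightarrow> nat \<Rightarrow> real \<times> (nat \<Rightarrow> nat \<Rightarrow> int) \<Rightarrow> real" where
  "decode k n R J \<delta> b = (\<lambda>(W, u). of_int (l1 n (SOME x. consistent n R J \<delta> b u x)) / (real k * W))"

definition bias_state :: "nat \<Rightarrow> nat \<Rightarrow> nat \<Rightarrow> nat \<Rightarrow> coefficients \<Rightarrow> stream \<Rightarrow> real \<times> (nat \<Rightarrow> nat \<Rightarrow> int)" where
  "bias_state k n R J \<omega> \<Psi> = (total_weight \<Psi>, projections n R J \<omega> (int_diff k \<Psi>))"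

text \<open>Reducing the projection shifts the angle by a multiple of \<open>2 * pi\<close>.\<close>

lemma observation_projections:
  assumes "j < J"
  shows "observation R (projections n R J \<omega> x) j =
    (\<Sum>r<R. cos (pi * of_int (\<Sum>v<n. int (\<omega> j r v) * x v) / 2 ^ j)) / real R"
proof -
  have "cos (pi * of_int (m mod (2 * 2 ^ j)) / 2 ^ j) = cos (pi * of_int m / 2 ^ j)" for m :: int
  proof -
    have "real_of_int m = of_int (2 * 2 ^ j * (m div (2 * 2 ^ j)) + m mod (2 * 2 ^ j))" by simp
    then have "real_of_int m = 2 * 2 ^ j * of_int (m div (2 * 2 ^ j)) + of_int (m mod (2 * 2 ^ j))"
      by (simp only: of_int_add of_int_mult of_int_power of_int_numeral)
    then have "pi * of_int m / 2 ^ j = pi * of_int (m mod (2 * 2 ^ j)) / 2 ^ j + 2 * pi * of_int (m div (2 * 2 ^ j))"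
      by (simp add: field_simps)
    then show ?thesis by (simp add: cos_add)
  qed
  then show ?thesis using assms by (simp add: observation_def projections_def)
qed

lemma projections_add:
  "projections n R J \<omega> (\<lambda>v. x v + y v) =
    (\<lambda>j\<in>{..<J}. \<lambda>r\<in>{..<R}. (projections n R J \<omega> x j r + projections n R J \<omega> y j r) mod (2 * 2 ^ j))"
  by (auto simp: projections_def fun_eq_iff restrict_def mod_add_eq distrib_left sum.distrib)

text \<open>Each scale fails with probability at most \<open>4 / (R * \<delta>\<^sup>2)\<close>; the
  union bound over \<open>J\<close> scales stays below \<open>1 / 3\<close>, which is where the 12
  comes from.\<close>

lemma prob_projections_consistent:
  assumes \<delta>: "\<delta> > 0" and R: "R > 0" "12 * real J \<le> real R * \<delta>\<^sup>2" and x: "l1 n x < 2 ^ b"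
  shows "measure_pmf.prob (coeff_pmf n R J) {\<omega>. consistent n R J \<delta> b (projections n R J \<omega> x) x} \<ge> 2 / 3"
proof -
  let ?P = "coeff_pmf n R J"
  \<comment> \<open>The summand 0 is the phase in \<open>expectation_cos_projection\<close>.\<close>
  define f where "f j T = cos (0 + pi * of_int (\<Sum>v<n. int (T v) * x v) / real (2 ^ j))" for j :: nat and T :: "nat \<Rightarrow> nat"
  define Bad where "Bad j = {\<omega> :: nat \<Rightarrow> nat \<Rightarrow> nat. \<bar>(\<Sum>r<R. f j (\<omega> r)) / real R - (\<Prod>v<n. overlap (2 ^ j) (x v))\<bar> > \<delta>}" for j
  have bad: "measure_pmf.prob ?P {\<omega>. \<omega> j \<in> Bad j} \<le> 4 / (real R * \<delta>\<^sup>2)" if "j \<in> {..<J}" for j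
  proof -
    let ?Q = "Pi_pmf {..<n} 0 (\<lambda>_. fejer_pmf (2 ^ j))"
    have E: "measure_pmf.expectation ?Q (f j) = (\<Prod>v<n. overlap (2 ^ j) (x v))"
      unfolding f_def by (subst expectation_cos_projection) auto
    have "measure_pmf.prob ?P {\<omega>. \<omega> j \<in> Bad j} = measure_pmf.prob (map_pmf (\<lambda>\<omega>. \<omega> j) ?P) (Bad j)"
      by (simp add: vimage_def)
    also have "map_pmf (\<lambda>\<omega>. \<omega> j) ?P = Pi_pmf {..<R} (\<lambda>_. 0) (\<lambda>_. ?Q)"
      unfolding coeff_pmf_def using that by (subst Pi_pmf_component) auto
    also have "measure_pmf.prob \<dots> (Bad j) \<le> 4 / (real R * \<delta>\<^sup>2)"
      unfolding Bad_def E[symmetric]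
      by (rule prob_average_deviation) (auto intro!: finite_set_Pi_pmf \<delta> R simp: f_def)
    finally show ?thesis .
  qed
  have good: "consistent n R J \<delta> b (projections n R J \<omega> x) x" if "\<omega> \<notin> (\<Union>j<J. {\<omega>. \<omega> j \<in> Bad j})" for \<omega>
    unfolding consistent_def
  proof (intro conjI allI impI x)
    fix j assume j: "j < J"
    with that have "\<omega> j \<notin> Bad j" by auto
    then show "\<bar>observation R (projections n R J \<omega> x) j - (\<Prod>v<n. overlap (2 ^ j) (x v))\<bar> \<le> \<delta>"
      unfolding observation_projections[OF j] by (simp add: Bad_def f_def)
  qed
  have "measure_pmf.prob ?P (\<Union>j<J. {\<omega>. \<omega> j \<in> Bad j}) \<le> (\<Sum>j<J. measure_pmf.prob ?P {\<omega>. \<omega> j \<in> Bad j})"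
    by (rule measure_pmf.finite_measure_subadditive_finite) auto
  also have "\<dots> \<le> (\<Sum>j<J. 4 / (real R * \<delta>\<^sup>2))" by (rule sum_mono) (rule bad)
  also have "\<dots> \<le> 1 / 3" using R \<delta> by (simp add: field_simps)
  finally have "2 / 3 \<le> 1 - measure_pmf.prob ?P (\<Union>j<J. {\<omega>. \<omega> j \<in> Bad j})" by simp
  also have "\<dots> = measure_pmf.prob ?P (- (\<Union>j<J. {\<omega>. \<omega> j \<in> Bad j}))"
    using measure_pmf.prob_compl[of "\<Union>j<J. {\<omega>. \<omega> j \<in> Bad j}" ?P] by (simp add: Compl_eq_Diff_UNIV)
  also have "\<dots> \<le> measure_pmf.prob ?P {\<omega>. consistent n R J \<delta> b (projections n R J \<omega> x) x}"
    using good by (intro measure_pmf.finite_measure_mono) (blast, simp)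
  finally show ?thesis .
qed

text \<open>Two vectors consistent with the same data have products within
  \<open>2 * \<delta>\<close> of each other. Accuracy \<open>e / 2\<close> is asked for because
  \<open>(1 + e) * (1 - e / 2) \<ge> 1\<close> turns the one-sided bound around.\<close>

lemma l1_relative_error:
  assumes x: "consistent n R (a + b + 1) \<delta> b u x" and y: "consistent n R (a + b + 1) \<delta> b u y"
    and \<delta>: "8 * \<delta> * 2 ^ a \<le> e / 2" and a: "1 / 2 ^ a \<le> e / 2" and e: "e \<le> 1"
  shows "(1 - e) * of_int (l1 n x) \<le> of_int (l1 n y)" "of_int (l1 n y) \<le> (1 + e) * of_int (l1 n x)"
proof -
  have close: "\<bar>(\<Prod>v<n. overlap (2 ^ j) (x v)) - (\<Prod>v<n. overlap (2 ^ j) (y v))\<bar> \<le> 2 * \<delta>"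
    "\<bar>(\<Prod>v<n. overlap (2 ^ j) (y v)) - (\<Prod>v<n. overlap (2 ^ j) (x v))\<bar> \<le> 2 * \<delta>"
    if "j < a + b + 1" for j
  proof -
    have "\<bar>observation R u j - (\<Prod>v<n. overlap (2 ^ j) (x v))\<bar> \<le> \<delta>"
      "\<bar>observation R u j - (\<Prod>v<n. overlap (2 ^ j) (y v))\<bar> \<le> \<delta>"
      using x y that by (auto simp: consistent_def)
    then show "\<bar>(\<Prod>v<n. overlap (2 ^ j) (x v)) - (\<Prod>v<n. overlap (2 ^ j) (y v))\<bar> \<le> 2 * \<delta>"
      "\<bar>(\<Prod>v<n. overlap (2 ^ j) (y v)) - (\<Prod>v<n. overlap (2 ^ j) (x v))\<bar> \<le> 2 * \<delta>"
      by linarith+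
  qed
  have bound: "l1 n x < 2 ^ b" "l1 n y < 2 ^ b" using x y by (auto simp: consistent_def)
  have nonneg: "0 \<le> real_of_int (l1 n x)" "0 \<le> real_of_int (l1 n y)" using l1_nonneg by auto
  have "0 < 1 / (2::real) ^ a" by simp
  with a have e0: "0 \<le> e" by linarith
  have "(1 - e) * of_int (l1 n x) \<le> of_int (l1 n y) \<and> of_int (l1 n y) \<le> (1 + e) * of_int (l1 n x)"
  proof (cases "l1 n x \<le> l1 n y")
    case True
    have "(1 - e / 2) * of_int (l1 n y) \<le> of_int (l1 n x)"
      by (rule l1_le_if_observations_close[OF close(1) bound(2) \<delta> a True])
    then have "(1 + e) * ((1 - e / 2) * of_int (l1 n y)) \<le> (1 + e) * of_int (l1 n x)"
      using e0 by (intro mult_left_mono) auto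
    moreover have "1 * of_int (l1 n y) \<le> (1 + e) * (1 - e / 2) * real_of_int (l1 n y)"
    proof (rule mult_right_mono)
      have "0 \<le> e * (1 - e)" using e e0 by simp
      then show "1 \<le> (1 + e) * (1 - e / 2)" by (simp add: field_simps)
    qed (rule nonneg)
    moreover have "(1 - e) * real_of_int (l1 n x) \<le> 1 * real_of_int (l1 n x)"
      using e0 nonneg by (intro mult_right_mono) auto
    moreover have "real_of_int (l1 n x) \<le> real_of_int (l1 n y)" using True by simp
    ultimately show ?thesis unfolding mult.assoc by linarith
  next
    case False
    then have le: "l1 n y \<le> l1 n x" by simp
    have "(1 - e / 2) * of_int (l1 n x) \<le> of_int (l1 n y)"
      by (rule l1_le_if_observations_close[OF close(2) bound(1) \<delta> a le])
    moreover have "0 \<le> e * real_of_int (l1 n x)" using e0 nonneg by simp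
    moreover have "real_of_int (l1 n y) \<le> real_of_int (l1 n x)" using le by simp
    ultimately show ?thesis by (simp add: algebra_simps)
  qed
  then show "(1 - e) * of_int (l1 n x) \<le> of_int (l1 n y)" "of_int (l1 n y) \<le> (1 + e) * of_int (l1 n x)" by auto
qed

lemma bias_eq_l1:
  assumes "\<Psi> \<in> integer_streams k n M"
  shows "bias k n \<Psi> = of_int (l1 n (int_diff k \<Psi>)) / (real k * total_weight \<Psi>)"
  by (simp add: bias_def l1_def of_int_int_diff[OF assms])

text \<open>If the true vector is consistent, then so is the decoded one, and their norms are close.
  The total weight is stored exactly, so dividing by it preserves the relative error.\<close>

lemma estimates_bias_decode:
  assumes k: "k \<ge> 1" and e: "e \<le> 1" and \<delta>: "\<delta> > 0" "8 * \<delta> * 2 ^ a \<le> e / 2" and a: "1 / 2 ^ a \<le> e / 2"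
    and b: "k * M + 1 \<le> 2 ^ b" and J: "J = a + b + 1"
    and R: "R > 0" "12 * real J \<le> real R * \<delta>\<^sup>2"
  shows "estimates_bias_on e k n (integer_streams k n M)
    (map_pmf (\<lambda>\<omega> \<Psi>. decode k n R J \<delta> b (bias_state k n R J \<omega> \<Psi>)) (coeff_pmf n R J))"
  unfolding estimates_bias_on_def
proof (intro ballI impI)
  fix \<Psi> assume \<Psi>: "\<Psi> \<in> integer_streams k n M" and W: "total_weight \<Psi> > 0"
  let ?x = "int_diff k \<Psi>"
  have "real_of_int (l1 n ?x) = bias k n \<Psi> * (real k * total_weight \<Psi>)"
    using W k by (simp add: bias_eq_l1[OF \<Psi>])
  also have "\<dots> \<le> 1 * (real k * real M)"
    using bias_range[OF integer_streamsD(1)[OF \<Psi>] W k] integer_streamsD(3)[OF \<Psi>] W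
    by (intro mult_mono) auto
  also have "\<dots> = real (k * M)" by simp
  also have "\<dots> < real (2 ^ b)" using b by (simp only: of_nat_less_iff)
  finally have "real_of_int (l1 n ?x) < of_int (2 ^ b)" by simp
  then have x: "l1 n ?x < 2 ^ b" by (simp only: of_int_less_iff)
  have good: "(1 - e) * bias k n \<Psi> \<le> decode k n R J \<delta> b (bias_state k n R J \<omega> \<Psi>) \<and>
      decode k n R J \<delta> b (bias_state k n R J \<omega> \<Psi>) \<le> (1 + e) * bias k n \<Psi>"
    if "consistent n R J \<delta> b (projections n R J \<omega> ?x) ?x" for \<omega>
  proof -
    let ?u = "projections n R J \<omega> ?x"
    define y where "y = (SOME y. consistent n R J \<delta> b ?u y)"
    have y: "consistent n R J \<delta> b ?u y" unfolding y_def using that by (rule someI[of "consistent n R J \<delta> b ?u"])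
    have dec: "decode k n R J \<delta> b (bias_state k n R J \<omega> \<Psi>) = of_int (l1 n y) / (real k * total_weight \<Psi>)"
      by (simp add: decode_def bias_state_def y_def)
    note l1_relative_error[OF that[unfolded J] y[unfolded J] \<delta>(2) a e]
    then show ?thesis
      unfolding dec bias_eq_l1[OF \<Psi>] times_divide_eq_right using W k
      by (intro conjI divide_right_mono) auto
  qed
  have "2 / 3 \<le> measure_pmf.prob (coeff_pmf n R J) {\<omega>. consistent n R J \<delta> b (projections n R J \<omega> ?x) ?x}"
    by (rule prob_projections_consistent[OF \<delta>(1) R x])
  also have "\<dots> \<le> measure_pmf.prob (coeff_pmf n R J)
      ((\<lambda>\<omega> \<Psi>. decode k n R J \<delta> b (bias_state k n R J \<omega> \<Psi>)) -`
        {A. (1 - e) * bias k n \<Psi> \<le> A \<Psi> \<and> A \<Psi> \<le> (1 + e) * bias k n \<Psi>})"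
    using good by (intro measure_pmf.finite_measure_mono) auto
  finally show "2 / 3 \<le> measure_pmf.prob
      (map_pmf (\<lambda>\<omega> \<Psi>. decode k n R J \<delta> b (bias_state k n R J \<omega> \<Psi>)) (coeff_pmf n R J))
      {A. (1 - e) * bias k n \<Psi> \<le> A \<Psi> \<and> A \<Psi> \<le> (1 + e) * bias k n \<Psi>}"
    by simp
qed

text \<open>The coefficients \<open>\<omega>\<close> belong to the deterministic algorithm and are
  not stored. The total weight takes \<open>b\<close> bits, and each of the \<open>R * J\<close>
  residues at most \<open>J\<close> bits.\<close>

lemma sketchable_decode:
  assumes b: "M + 1 \<le> 2 ^ b"
  shows "sketchable (b + R * J * J) (integer_streams k n M) (\<lambda>\<Psi>. decode k n R J \<delta> b' (bias_state k n R J \<omega> \<Psi>))"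
proof (rule sketchable_if_finite_state)
  let ?U = "\<lambda>j :: nat. {0..<2 * 2 ^ j :: int}"
  let ?T = "real ` {..M} \<times> (\<Pi>\<^sub>E j\<in>{..<J}. \<Pi>\<^sub>E r\<in>{..<R}. ?U j)"
  show "finite ?T" by (intro finite_cartesian_product finite_PiE) auto
  have "card ?T = (M + 1) * (\<Prod>j<J. (2 * 2 ^ j) ^ R)"
    by (simp add: card_cartesian_product card_PiE card_image nat_mult_distrib nat_power_eq)
  also have "\<dots> \<le> 2 ^ b * (\<Prod>j<J. (2 ^ J) ^ R)"
  proof (rule mult_mono[OF b prod_mono])
    fix j assume "j \<in> {..<J}"
    then have "(2::nat) ^ Suc j \<le> 2 ^ J" by (intro power_increasing) auto
    then show "0 \<le> (2 * 2 ^ j :: nat) ^ R \<and> (2 * 2 ^ j :: nat) ^ R \<le> (2 ^ J) ^ R"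
      using power_mono[of "2 * 2 ^ j :: nat" "2 ^ J" R] by simp
  qed auto
  also have "\<dots> = 2 ^ (b + R * J * J)"
    by (simp add: power_add flip: power_mult)
  finally show "card ?T \<le> 2 ^ (b + R * J * J)" .
  show "bias_state k n R J \<omega> \<Psi> \<in> ?T" if "\<Psi> \<in> integer_streams k n M" for \<Psi>
    using total_weight_integer_stream[OF that] by (auto simp: bias_state_def projections_def)
  show "bias_state k n R J \<omega> (\<Psi> @ \<Phi>) =
      (\<lambda>(W, u) (W', u'). (W + W', \<lambda>j\<in>{..<J}. \<lambda>r\<in>{..<R}. (u j r + u' j r) mod (2 * 2 ^ j)))
        (bias_state k n R J \<omega> \<Psi>) (bias_state k n R J \<omega> \<Phi>)"
    if "\<Psi> \<in> integer_streams k n M" "\<Phi> \<in> integer_streams k n M" for \<Psi> \<Phi>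
  proof -
    have "int_diff k (\<Psi> @ \<Phi>) = (\<lambda>v. int_diff k \<Psi> v + int_diff k \<Phi> v)"
      using int_diff_append[OF that] by (rule ext)
    then show ?thesis
      by (simp add: bias_state_def total_weight_def projections_add)
  qed
qed (rule refl)

section \<open>Choice of the parameters and space bound\<close>

lemma ex_power_two_bounds:
  assumes "m \<ge> (1 :: nat)"
  shows "\<exists>b. m \<le> 2 ^ b \<and> real b \<le> 1 + log 2 (real m)"
proof -
  obtain q where q: "2 ^ q \<le> m" "m < 2 ^ (q + 1)"
    using ex_power_ivl1[of 2 m] assms by auto
  have "real (2 ^ q) \<le> real m" using q(1) by (simp only: of_nat_le_iff)
  then have "real q \<le> log 2 (real m)"
    using assms by (simp add: le_log_iff powr_realpow)
  with q show ?thesis by (intro exI[of _ "q + 1"]) auto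
qed

text \<open>For fixed \<open>k\<close> and \<open>e\<close>, each of \<open>b\<close>,
  \<open>J\<close> and \<open>R\<close> is at most linear in the logarithm, so
  \<open>b + R * J * J\<close> is at most cubic: \<open>d = 3\<close>.\<close>

lemma ex_bias_sketch:
  assumes k: "k \<ge> 1" and e: "0 < e" "e \<le> 1"
  shows "\<exists>(C :: real) (d :: nat). \<forall>n M. \<exists>s \<A>.
       real s \<le> C * log 2 (real n + real M + 2) ^ d \<and>
       sketching_algorithm s (integer_streams k n M) \<A> \<and>
       estimates_bias_on e k n (integer_streams k n M) \<A>"
proof -
  obtain a where a: "1 / 2 ^ a < e / 2"
    using e one_less_inverse reals_power_lt_ex[of "e / 2" 2] by (auto simp: power_one_over inverse_eq_divide)
  \<comment> \<open>The largest value with \<open>8 * \<delta> * 2 ^ a \<le> e / 2\<close>.\<close>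
  define \<delta> where "\<delta> = e / (16 * 2 ^ a)"
  have \<delta>: "\<delta> > 0" "8 * \<delta> * 2 ^ a \<le> e / 2" using e by (simp_all add: \<delta>_def)
  \<comment> \<open>The slopes in \<open>b \<le> cb * l\<close>, \<open>J \<le> cJ * l\<close> and
    \<open>R \<le> cR * l\<close> below, where additive constants are absorbed by
    \<open>l \<ge> 1\<close>.\<close>
  define cb cJ cR where "cb = 2 + log 2 (real k)" and "cJ = real a + 1 + cb" and "cR = 12 * cJ / \<delta>\<^sup>2 + 1"
  have c0: "0 \<le> cb" "0 \<le> cJ" "0 \<le> cR" using k by (simp_all add: cb_def cJ_def cR_def add_nonneg_nonneg)
  have "\<exists>s \<A>. real s \<le> (cb + cR * cJ * cJ) * log 2 (real n + real M + 2) ^ 3 \<and>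
       sketching_algorithm s (integer_streams k n M) \<A> \<and>
       estimates_bias_on e k n (integer_streams k n M) \<A>" for n M
  proof -
    define l where "l = log 2 (real n + real M + 2)"
    have l1: "1 \<le> l" by (simp add: l_def le_log_iff)
    obtain b where b: "k * M + 1 \<le> 2 ^ b" "real b \<le> 1 + log 2 (real (k * M + 1))"
      using ex_power_two_bounds[of "k * M + 1"] by auto
    have "real (k * M + 1) \<le> real k * (real n + real M + 2)"
      using k mult_mono[of 1 "real k" 1 "real n + 2"] by (simp add: algebra_simps)
    then have "log 2 (real (k * M + 1)) \<le> log 2 (real k * (real n + real M + 2))"
      using k by (subst log_le_cancel_iff) (auto intro: add_pos_nonneg)
    also have "\<dots> = log 2 (real k) + l" using k by (subst log_mult) (auto simp: l_def)
    finally have "real b \<le> 1 + log 2 (real k) + l" using b(2) by simp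
    also have "\<dots> \<le> cb * l"
    proof -
      have "(1 + log 2 (real k)) * 1 \<le> (1 + log 2 (real k)) * l" using k l1 by (intro mult_left_mono) auto
      then show ?thesis by (simp add: cb_def algebra_simps)
    qed
    finally have bl: "real b \<le> cb * l" .
    define J where "J = a + b + 1"
    have Jl: "real J \<le> cJ * l"
    proof -
      have "(real a + 1) * 1 \<le> (real a + 1) * l" using l1 by (intro mult_left_mono) auto
      with bl show ?thesis by (simp add: J_def cJ_def algebra_simps)
    qed
    define R where "R = nat \<lceil>12 * real J / \<delta>\<^sup>2\<rceil>"
    have "0 < 12 * real J / \<delta>\<^sup>2" using \<delta> by (simp add: J_def)
    then have R: "R > 0" "12 * real J / \<delta>\<^sup>2 \<le> real R" "real R \<le> 12 * real J / \<delta>\<^sup>2 + 1"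
      unfolding R_def by linarith+
    have R': "12 * real J \<le> real R * \<delta>\<^sup>2" using R(2) \<delta>(1) by (simp add: field_simps)
    have Rl: "real R \<le> cR * l"
    proof -
      have "12 * real J / \<delta>\<^sup>2 \<le> 12 * (cJ * l) / \<delta>\<^sup>2" using Jl by (intro divide_right_mono) auto
      with R(3) l1 show ?thesis by (simp add: cR_def distrib_right)
    qed
    let ?s = "b + R * J * J"
    let ?A = "map_pmf (\<lambda>\<omega> \<Psi>. decode k n R J \<delta> b (bias_state k n R J \<omega> \<Psi>)) (coeff_pmf n R J)"
    have "real R * real J * real J \<le> (cR * l) * (cJ * l) * (cJ * l)"
      using Rl Jl c0 l1 by (intro mult_mono) auto
    moreover have "cb * l \<le> cb * l ^ 3"
      using c0 l1 power_increasing[of 1 3 l] by (intro mult_left_mono) auto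
    ultimately have "real ?s \<le> (cb + cR * cJ * cJ) * l ^ 3"
      using bl by (simp add: power3_eq_cube algebra_simps)
    moreover have "M + 1 \<le> 2 ^ b"
      using b(1) k by (metis add_le_mono1 le_trans mult_le_mono1 nat_mult_1)
    then have "sketching_algorithm ?s (integer_streams k n M) ?A"
      by (auto simp: sketching_algorithm_def intro: sketchable_decode)
    moreover have "estimates_bias_on e k n (integer_streams k n M) ?A"
      using k e(2) \<delta> less_imp_le[OF a] b(1) J_def R(1) R' by (rule estimates_bias_decode)
    ultimately show ?thesis unfolding l_def by blast
  qed
  then show ?thesis by blast
qed

theorem theorem1p7:
  fixes i k :: nat and S :: "nat set" and \<epsilon> :: real
  assumes "1 \<le> i" and "i \<le> k" and "S = {i..k}" and "\<epsilon> > 0"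
  shows "\<exists>(\<gamma> :: real \<Rightarrow> real) (\<epsilon>' :: real).
    piecewise_linear_on (-1) 1 \<gamma> \<and> \<gamma> ` {-1..1} \<subseteq> {0..1} \<and> \<epsilon>' > 0 \<and>
    (\<forall>n X \<A>. X \<subseteq> csp_streams k n \<and> estimates_bias_on \<epsilon>' k n X \<A> \<longrightarrow>
       approximates_on (real_of_ereal (alpha k (sym_pred S)) - \<epsilon>) (sym_pred S) n X
         (bias_algorithm \<gamma> \<A>) \<and>
       (\<forall>s. sketching_algorithm s X \<A> \<longrightarrow> sketching_algorithm s X (bias_algorithm \<gamma> \<A>))) \<and>
    (\<exists>(C :: real) (d :: nat). \<forall>n M. \<exists>s \<A>.
       real s \<le> C * log 2 (real n + real M + 2) ^ d \<and>
       sketching_algorithm s (integer_streams k n M) \<A> \<and>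
       estimates_bias_on \<epsilon>' k n (integer_streams k n M) \<A>)"
proof -
  \<comment> \<open>\<open>2 * e \<le> \<epsilon>\<close> pays for the factor
    \<open>(1 - e) / (1 + e)\<close>, and \<open>e \<le> 1\<close> is the range of the relative
    error lemmas.\<close>
  define e where "e = min 1 (\<epsilon> / 2)"
  have e: "0 < e" "e \<le> 1" "2 * e \<le> \<epsilon>" using assms(4) by (auto simp: e_def)
  define a where "a = real_of_ereal (alpha k (sym_pred {i..k}))"
  define \<gamma> where "\<gamma> = (\<lambda>x. a / (1 + e) * gamma_star k i x)"
  have "0 \<le> a" "a \<le> 1"
    using alpha_range[OF assms(2)] by (cases "alpha k (sym_pred {i..k})"; simp add: a_def)+
  then have a: "a / (1 + e) \<in> {0..1}" using e by simp
  have range: "\<gamma> ` {-1..1} \<subseteq> {0..1}"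
  proof
    fix y assume "y \<in> \<gamma> ` {-1..1}"
    then obtain x where x: "-1 \<le> x" "y = a / (1 + e) * gamma_star k i x" by (auto simp: \<gamma>_def)
    with a gamma_star_range[OF x(1), of k i] show "y \<in> {0..1}"
      by (auto simp del: times_divide_eq_left intro: mult_le_one)
  qed
  have "piecewise_linear_on (-1) 1 \<gamma>"
    unfolding \<gamma>_def by (rule piecewise_linear_gamma_star[OF assms(1,2)])
  moreover have "approximates_on (a - \<epsilon>) (sym_pred {i..k}) n X (bias_algorithm \<gamma> \<A>)"
    if "X \<subseteq> csp_streams k n" "estimates_bias_on e k n X \<A>" for n X \<A>
    unfolding a_def \<gamma>_def by (rule bias_algorithm_approximates[OF assms(1,2) e that])
  moreover have "k \<ge> 1" using assms(1,2) by simp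
  note ex_bias_sketch[OF this e(1,2)]
  ultimately show ?thesis
    unfolding assms(3) using range e(1) sketching_bias_algorithm
    by (intro exI[of _ \<gamma>] exI[of _ e]) (auto simp: a_def)
qed

end
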